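(* For every real $Q\geq 1$ there are smooth functions $p_q(z)$ of a real variable $z$ ($1\leq q\leq Q$, $q\in\mathbb{N}$; $p_q$ depends only on $q$ and $Q$) satisfying, for every $N\geq 0$, \[ p_q(z)\ll_N 1,\qquad\text{and}\qquad p_q(z)=1+O_N\big((q/Q)^N\big)\ \text{ for } |z|\leq Q^{-2}, \] such that for every integer $n$, every $\theta>0$ and every $N\geq 0$, \[ \delta_0(n)=\sum_{1\leq q\leq Q}\ \sum_{\substack{1\leq a\leq q\\ \gcd(a,q)=1}}\ \int_{|z|<(qQ)^{-1+\theta}}p_q(z)\,e\big((a/q+z)n\big)\,dz+O_{N,\theta}(Q^{-N\theta}). \]
   Context: $\delta_0(n)=1$ if $n=0$ and $\delta_0(n)=0$ for every other integer $n$. $e(x)=e^{2\pi i x}$. Implied constants depend only on the indicated parameters. *)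

theory Defs
  imports "HOL-Analysis.Analysis"
begin

definition e :: "real \<Rightarrow> complex" where
  "e x = exp (2 * of_real pi * \<i> * of_real x)"

definition delta0 :: "int \<Rightarrow> complex" where
  "delta0 n = (if n = 0 then 1 else 0)"

(* C-infinity on the whole real line: every iterated derivative is again differentiable everywhere.
   The operator deriv is only available for functions from a field to itself, hence the vector
   derivative. *)
definition smooth :: "(real \<Rightarrow> 'a::real_normed_vector) \<Rightarrow> bool" where
  "smooth f \<longleftrightarrow>
    (\<forall>k x. ((\<lambda>g t. vector_derivative g (at t)) ^^ k) f differentiable at x)"

end

theory Submission
  imports Defs "HOL-Probability.Probability"
begin

text \<open>
  Choose even smooth functions \<open>\<phi>\<close> and \<open>\<eta>\<close> supported in \<open>[-1, 1]\<close> with \<open>\<phi>(0) = 0\<close>, \<open>\<eta>(0) = 1\<close> and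
  integral of \<open>\<phi>\<close> equal to \<open>1\<close>. Write \<open>\<phi>'\<close> and \<open>\<eta>'\<close> for their Fourier transforms, put
  \<open>F(x, y) = \<phi>(x) \<eta>'(y) - \<eta>(x) \<phi>'(y)\<close>, and let
  \<open>p\<^sub>q(z) = 2 \<Sum> F(j q / Q, j q Q z)\<close>, summed over \<open>j \<ge> 1\<close>; only \<open>j \<le> Q / q\<close> contribute. This is
  \<open>delta_kernel\<close>, a version of the delta symbol of Duke, Friedlander and Iwaniec.

  By Fourier inversion, the integral of \<open>p\<^sub>q(z) e((a/q + z) n)\<close> over the whole line is a sum over \<open>j\<close> of
  \<open>e(an/q) c(j q)\<close>, where
  \<open>c(d) = 2/(d Q) (\<phi>(d/Q) \<eta>(n/(d Q)) - \<eta>(d/Q) \<phi>(n/(d Q)))\<close> depends only on \<open>d = j q\<close>. Summing over the reduced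
  fractions \<open>a/q\<close> and collecting the terms with equal \<open>d\<close> gives all fractions \<open>b/d\<close>, hence the sum of \<open>d c(d)\<close>
  over the divisors \<open>d \<le> Q\<close> of \<open>n\<close> (\<open>farey_sum_integral\<close>).
  For \<open>n \<noteq> 0\<close> it vanishes, because exchanging \<open>d\<close> and \<open>\<bar>n\<bar>/d\<close> changes the sign (\<open>divisor_sum_eq_0\<close>); for \<open>n = 0\<close> it is a
  Riemann sum for the integral of \<open>\<phi>\<close> and equals \<open>1\<close> up to an arbitrary power of \<open>1/Q\<close>
  (\<open>divisor_sum_0_approx\<close>).

  The remaining claims concern the size of \<open>p\<^sub>q\<close>. Rapid decay of \<open>\<phi>'\<close> and \<open>\<eta>'\<close> gives rapid decay of
  \<open>p\<^sub>q(z)\<close> in \<open>q Q \<bar>z\<bar>\<close> (\<open>delta_kernel_decay\<close>), which permits truncating the integral. For small \<open>z\<close>, the sum of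
  \<open>F(j x, j y)\<close> over all integers \<open>j\<close> is compared with the integral of \<open>F(t x, t y)\<close> over \<open>t\<close>.
  That integral is \<open>0\<close> by the multiplication formula for Fourier transforms, and Euler-Maclaurin summation bounds the
  difference by a constant times \<open>max x \<bar>y\<bar> ^ N\<close> for every \<open>N\<close>. As \<open>F\<close> is even and \<open>F(0, 0) = -1\<close>, this shows
  that \<open>p\<^sub>q(z) - 1\<close> is bounded by the same quantity with \<open>x = q/Q\<close> and \<open>y = q Q z\<close> (\<open>delta_kernel_minus_1\<close>).
\<close>

section \<open>Bump functions\<close>

text \<open>
  The function \<open>bump P n\<close> is \<open>P(x) (1 - x\<^sup>2)\<^sup>-\<^sup>n exp (-1 / (1 - x\<^sup>2))\<close> on \<open>(-1, 1)\<close>,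
  extended by \<open>0\<close>. This family of smooth functions supported in \<open>[-1, 1]\<close> is closed under
  differentiation and under multiplication by polynomials, so that statements about all
  derivatives of one of its members can be proved as statements about single members of the family.
\<close>

definition bump :: "real poly \<Rightarrow> nat \<Rightarrow> real \<Rightarrow> real" where
  "bump P n x = (if \<bar>x\<bar> < 1 then poly P x / (1 - x\<^sup>2) ^ n * exp (- 1 / (1 - x\<^sup>2)) else 0)"

text \<open>
  The polynomial factor of the derivative of \<open>bump P n\<close>, whose exponent is \<open>n + 2\<close>.
\<close>

definition bump_deriv :: "real poly \<Rightarrow> nat \<Rightarrow> real poly" where
  "bump_deriv P n = pderiv P * [:1, 0, -1:]\<^sup>2 + smult (2 * real n) ([:0, 1:] * P * [:1, 0, -1:])
     - smult 2 ([:0, 1:] * P)"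

lemma bump_eq_0: "\<bar>x\<bar> \<ge> 1 \<Longrightarrow> bump P n x = 0"
  by (simp add: bump_def)

lemma bump_pCons: "x * bump P n x = bump (pCons 0 P) n x"
  by (simp add: bump_def)

lemma bump_smult: "c * bump P n x = bump (smult c P) n x"
  by (simp add: bump_def)

lemma bump_minus: "(\<And>x. poly P (- x) = poly P x) \<Longrightarrow> bump P n (- x) = bump P n x"
  by (simp add: bump_def)

lemma exp_minus_inverse_le:
  fixes s :: real
  assumes "s > 0"
  shows "exp (- 1 / s) / s ^ n \<le> real (n + 2) ^ (n + 2) * s\<^sup>2"
proof -
  define m where "m = n + 2"
  have "(1 + (1 / s) / real m) ^ m \<le> exp (1 / s)"
    by (rule exp_ge_one_plus_x_over_n_power_n) (use assms in \<open>auto simp: m_def intro: order_trans[of _ 0]\<close>)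
  moreover have "((1 / s) / real m) ^ m \<le> (1 + (1 / s) / real m) ^ m"
    by (rule power_mono) (use assms in auto)
  ultimately have "((1 / s) / real m) ^ m \<le> exp (1 / s)" by linarith
  moreover have "((1 / s) / real m) ^ m = inverse ((real m * s) ^ m)"
    by (simp add: divide_inverse power_inverse[symmetric] mult.commute del: power_inverse)
  ultimately have "inverse (exp (1 / s)) \<le> inverse (inverse ((real m * s) ^ m))"
    using assms by (intro le_imp_inverse_le) (auto simp: m_def)
  hence "exp (- (1 / s)) \<le> (real m * s) ^ m"
    by (simp add: exp_minus)
  hence "exp (- (1 / s)) / s ^ n \<le> (real m * s) ^ m / s ^ n"
    using assms by (intro divide_right_mono) auto
  also have "\<dots> = real m ^ m * s\<^sup>2"
    unfolding power_mult_distrib using assms by (simp add: m_def power_add power2_eq_square)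
  finally show ?thesis by (simp add: m_def)
qed

text \<open>
  The exponential beats the pole to second order at \<open>\<plusminus>1\<close>; this makes a bump, and hence each of its
  derivatives, differentiable there with derivative \<open>0\<close>.
\<close>

lemma bump_le:
  obtains C where "C \<ge> 0" "\<And>x. \<bar>x\<bar> < 1 \<Longrightarrow> \<bar>bump P n x\<bar> \<le> C * (1 - \<bar>x\<bar>)\<^sup>2"
proof -
  have "bounded (poly P ` {-1..1})"
    by (intro compact_imp_bounded compact_continuous_image continuous_intros) auto
  then obtain B where B: "\<And>x. x \<in> {-1..1} \<Longrightarrow> \<bar>poly P x\<bar> \<le> B"
    unfolding bounded_iff by (metis imageI real_norm_def)
  have B0: "B \<ge> 0" using B[of 0] by auto
  define K where "K = real (n + 2) ^ (n + 2)"
  have "\<bar>bump P n x\<bar> \<le> 4 * B * K * (1 - \<bar>x\<bar>)\<^sup>2" if "\<bar>x\<bar> < 1" for x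
  proof -
    define s where "s = 1 - x\<^sup>2"
    have s: "s > 0" using that by (simp add: s_def abs_square_less_1)
    have "s = (1 - \<bar>x\<bar>) * (1 + \<bar>x\<bar>)"
      by (simp add: s_def algebra_simps power2_eq_square)
    also have "\<dots> \<le> (1 - \<bar>x\<bar>) * 2"
      using that by (intro mult_left_mono) auto
    finally have "s\<^sup>2 \<le> ((1 - \<bar>x\<bar>) * 2)\<^sup>2" using s by (intro power_mono) auto
    hence s2: "s\<^sup>2 \<le> 4 * (1 - \<bar>x\<bar>)\<^sup>2" by (simp only: power_mult_distrib) simp
    have "\<bar>bump P n x\<bar> = \<bar>poly P x\<bar> * (exp (- 1 / s) / s ^ n)"
      using that s by (simp add: bump_def s_def[symmetric] abs_mult)
    also have "\<dots> \<le> B * (K * s\<^sup>2)"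
      unfolding K_def
      using that s by (intro mult_mono B exp_minus_inverse_le) (auto simp: B0)
    also have "\<dots> \<le> B * (K * (4 * (1 - \<bar>x\<bar>)\<^sup>2))"
      by (intro mult_left_mono s2) (auto simp: B0 K_def)
    finally show ?thesis by (simp add: mult_ac)
  qed
  thus ?thesis using that[of "4 * B * K"] B0 by (simp add: K_def)
qed

lemma has_real_derivative_bump:
  "(bump P n has_real_derivative bump (bump_deriv P n) (n + 2) x) (at x)"
proof (cases "\<bar>x\<bar> < 1")
  case True
  define s where "s = 1 - x\<^sup>2"
  have s: "s > 0" using True by (simp add: s_def abs_square_less_1)
  have D: "((\<lambda>x. poly P x / (1 - x\<^sup>2) ^ n * exp (- 1 / (1 - x\<^sup>2))) has_real_derivative
      (poly (pderiv P) x / s ^ n + 2 * real n * x * poly P x / s ^ Suc n) * exp (- 1 / s)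
       - poly P x / s ^ n * (exp (- 1 / s) * (2 * x / s\<^sup>2))) (at x)"
  proof -
    have A: "((\<lambda>x. 1 - x\<^sup>2) has_real_derivative (- 2 * x)) (at x)"
      by (auto intro!: derivative_eq_intros)
    have B: "((\<lambda>x. (1 - x\<^sup>2) ^ n) has_real_derivative (real n * ((- 2 * x) * s ^ (n - Suc 0)))) (at x)"
      using DERIV_power[OF A, of n] by (simp add: s_def)
    have B': "real n * ((- 2 * x) * s ^ (n - Suc 0)) = - 2 * real n * x * s ^ n / s"
      using s by (cases n) (simp_all add: field_simps)
    have E1: "((\<lambda>x. - 1 / (1 - x\<^sup>2)) has_real_derivative (- (2 * x / s\<^sup>2))) (at x)"
      using DERIV_divide[OF DERIV_const[of "-1"] A] s by (simp add: s_def power2_eq_square)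
    have E2: "((\<lambda>x. exp (- 1 / (1 - x\<^sup>2))) has_real_derivative (exp (- 1 / s) * (- (2 * x / s\<^sup>2)))) (at x)"
      using DERIV_fun_exp[OF E1] by (simp add: s_def)
    have F: "((\<lambda>x. poly P x / (1 - x\<^sup>2) ^ n) has_real_derivative
        (poly (pderiv P) x * s ^ n - poly P x * (- 2 * real n * x * s ^ n / s)) / (s ^ n * s ^ n)) (at x)"
      using DERIV_divide[OF poly_DERIV[of P x] B[unfolded B']] s by (simp add: s_def)
    have F': "(poly (pderiv P) x * s ^ n - poly P x * (- 2 * real n * x * s ^ n / s)) / (s ^ n * s ^ n)
        = poly (pderiv P) x / s ^ n + 2 * real n * x * poly P x / s ^ Suc n"
      using s by (simp add: field_simps)
    show ?thesis
      using DERIV_mult[OF F[unfolded F'] E2] by (simp add: s_def[symmetric] algebra_simps)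
  qed
  have eq: "(poly (pderiv P) x / s ^ n + 2 * real n * x * poly P x / s ^ Suc n) * exp (- 1 / s)
       - poly P x / s ^ n * (exp (- 1 / s) * (2 * x / s\<^sup>2))
      = bump (bump_deriv P n) (n + 2) x"
  proof -
    have ps: "poly [:1, 0, -1:] x = s" 
      by (simp add: s_def power2_eq_square)
    have "poly (bump_deriv P n) x = poly (pderiv P) x * s\<^sup>2 + 2 * real n * (x * poly P x * s) - 2 * (x * poly P x)"
      unfolding bump_deriv_def by (simp only: poly_diff poly_add poly_mult poly_smult poly_power ps) simp
    hence "bump (bump_deriv P n) (n + 2) x = (poly (pderiv P) x * s\<^sup>2
        + 2 * real n * (x * poly P x * s) - 2 * (x * poly P x)) / s ^ (n + 2) * exp (- 1 / s)"
      using True by (simp add: bump_def s_def)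
    also have "\<dots> = (poly (pderiv P) x / s ^ n + 2 * real n * x * poly P x / s ^ Suc n) * exp (- 1 / s)
       - poly P x / s ^ n * (exp (- 1 / s) * (2 * x / s\<^sup>2))"
      using s by (simp add: power_add power2_eq_square add_divide_distrib diff_divide_distrib algebra_simps)
    finally show ?thesis ..
  qed
  show ?thesis
    using D[unfolded eq]
  proof (rule has_field_derivative_transform_within_open)
    show "open {-1<..<1::real}" by simp
  qed (use True in \<open>auto simp: bump_def\<close>)
next
  case False
  obtain C where C: "C \<ge> 0" "\<And>x. \<bar>x\<bar> < 1 \<Longrightarrow> \<bar>bump P n x\<bar> \<le> C * (1 - \<bar>x\<bar>)\<^sup>2"
    using bump_le[of P n] by blast
  have bd: "\<bar>bump P n y\<bar> \<le> C * \<bar>y - x\<bar>\<^sup>2" for y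
  proof (cases "\<bar>y\<bar> < 1")
    case True
    have "(1 - \<bar>y\<bar>)\<^sup>2 \<le> \<bar>y - x\<bar>\<^sup>2" using True False by (intro power_mono) auto
    thus ?thesis using C(2)[OF True] C(1) by (meson mult_left_mono order_trans)
  qed (use C in \<open>auto simp: bump_def\<close>)
  have "((\<lambda>y. (bump P n y - bump P n x) / (y - x)) \<longlongrightarrow> 0) (at x)"
  proof (rule Lim_null_comparison)
    show "\<forall>\<^sub>F y in at x. norm ((bump P n y - bump P n x) / (y - x)) \<le> C * \<bar>y - x\<bar>"
      using bd False by (auto simp: bump_eq_0 eventually_at_filter divide_simps power2_eq_square mult_ac)
    show "((\<lambda>y. C * \<bar>y - x\<bar>) \<longlongrightarrow> 0) (at x)"
      by (auto intro!: tendsto_eq_intros)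
  qed
  thus ?thesis using False
    by (simp add: has_field_derivative_iff bump_eq_0[of x])
qed

lemma continuous_on_bump [continuous_intros]:
  "continuous_on A f \<Longrightarrow> continuous_on A (\<lambda>x. bump P n (f x))"
  by (rule continuous_on_compose2[of UNIV "bump P n"])
    (auto intro!: DERIV_continuous_on has_real_derivative_bump[THEN has_field_derivative_at_within])

lemma bump_rapid:
  obtains C where "C \<ge> 0" "\<And>x. \<bar>bump P n x\<bar> \<le> C / (1 + x\<^sup>2)" "\<And>x. \<bar>bump P n x\<bar> \<le> C"
proof -
  obtain C where C: "C \<ge> 0" "\<And>x. \<bar>x\<bar> < 1 \<Longrightarrow> \<bar>bump P n x\<bar> \<le> C * (1 - \<bar>x\<bar>)\<^sup>2"
    using bump_le[of P n] by blast
  have bd: "\<bar>bump P n x\<bar> \<le> 2 * C / (1 + x\<^sup>2)" for x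
  proof (cases "\<bar>x\<bar> < 1")
    case True
    have "(1 - \<bar>x\<bar>)\<^sup>2 \<le> 1" using True by (simp add: abs_square_le_1)
    hence "\<bar>bump P n x\<bar> \<le> C" using C(2)[OF True] C(1) by (meson mult_left_le order_trans)
    moreover have "x\<^sup>2 \<le> 1" using True by (simp add: abs_square_le_1)
    hence "C * (1 + x\<^sup>2) \<le> C * 2" using C by (intro mult_left_mono) auto
    hence "C \<le> 2 * C / (1 + x\<^sup>2)" by (simp add: field_simps add_pos_nonneg)
    ultimately show ?thesis by linarith
  qed (use C in \<open>simp add: bump_eq_0\<close>)
  moreover have "2 * C / (1 + x\<^sup>2) \<le> 2 * C" for x
  proof -
    have "C * 1 \<le> C * (1 + x\<^sup>2)" using C by (intro mult_left_mono) auto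
    thus ?thesis by (simp add: field_simps add_pos_nonneg)
  qed
  ultimately show ?thesis using that[of "2 * C"] C(1) by (meson order_trans mult_nonneg_nonneg zero_le_numeral)
qed

section \<open>Cosine transforms\<close>

text \<open>
  The cosine transform of a function on \<open>[-1, 1]\<close> with a phase \<open>\<alpha>\<close>. For an even function supported there
  and \<open>\<alpha> = 0\<close> this is the Fourier transform. Differentiation and integration by parts both
  turn a sine into a cosine shifted by \<open>pi / 2\<close>, and the phase keeps track of these shifts.
\<close>

definition costrans :: "(real \<Rightarrow> real) \<Rightarrow> real \<Rightarrow> real \<Rightarrow> real" where
  "costrans f \<alpha> y = integral {-1..1} (\<lambda>u. f u * cos (2 * pi * u * y + \<alpha>))"

lemma cos_add_half_pi: "cos (x + pi / 2) = - sin (x :: real)"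
  by (simp add: cos_add)

lemma has_real_derivative_costrans:
  "(costrans (bump P n) \<alpha> has_real_derivative
     costrans (bump (smult (2 * pi) (pCons 0 P)) n) (\<alpha> + pi / 2) y) (at y)"
proof -
  have "((\<lambda>y. integral (cbox (-1) 1) (\<lambda>u. bump P n u * cos (2 * pi * u * y + \<alpha>))) has_field_derivative
     integral (cbox (-1) 1) ((\<lambda>y u. bump P n u * (- sin (2 * pi * u * y + \<alpha>) * (2 * pi * u))) y)) (at y within UNIV)"
    by (rule leibniz_rule_field_derivative)
      (auto intro!: derivative_eq_intros integrable_continuous_interval continuous_intros simp: split_beta)
  moreover have "bump P n u * (- sin (2 * pi * u * y + \<alpha>) * (2 * pi * u))
     = bump (smult (2 * pi) (pCons 0 P)) n u * cos (2 * pi * u * y + (\<alpha> + pi / 2))" for u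
    unfolding add.assoc[symmetric] cos_add_half_pi bump_smult[symmetric] bump_pCons[symmetric] by simp
  ultimately show ?thesis unfolding costrans_def[abs_def] by (simp only: interval_cbox)
qed

lemma continuous_on_costrans [continuous_intros]:
  "continuous_on A f \<Longrightarrow> continuous_on A (\<lambda>x. costrans (bump P n) \<alpha> (f x))"
  by (rule continuous_on_compose2[of UNIV "costrans (bump P n) \<alpha>"])
    (auto intro!: DERIV_continuous_on has_real_derivative_costrans[THEN has_field_derivative_at_within])

lemma costrans_by_parts:
  "2 * pi * y * costrans (bump P n) \<alpha> y = costrans (bump (bump_deriv P n) (n + 2)) (\<alpha> + pi / 2) y"
proof -
  define f where "f u = bump P n u * sin (2 * pi * u * y + \<alpha>)" for u
  define a where "a u = bump P n u * cos (2 * pi * u * y + \<alpha>)" for u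
  define b where "b u = bump (bump_deriv P n) (n + 2) u * cos (2 * pi * u * y + (\<alpha> + pi / 2))" for u
  have D: "(f has_vector_derivative (2 * pi * y * a u - b u)) (at u within {-1..1})" for u
    unfolding has_real_derivative_iff_has_vector_derivative[symmetric] f_def[abs_def] a_def b_def
      add.assoc[symmetric] cos_add_half_pi
    by (rule derivative_eq_intros refl has_real_derivative_bump[THEN has_field_derivative_at_within])+ simp
  have int: "a integrable_on {-1..1}" "b integrable_on {-1..1}"
    unfolding a_def[abs_def] b_def[abs_def] by (intro integrable_continuous_interval continuous_intros)+
  have "((\<lambda>u. 2 * pi * y * a u - b u) has_integral (f 1 - f (-1))) {-1..1}"
    by (rule fundamental_theorem_of_calculus) (use D in auto)
  hence "integral {-1..1} (\<lambda>u. 2 * pi * y * a u - b u) = 0"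
    by (simp add: f_def bump_eq_0 integral_unique)
  moreover have "integral {-1..1} (\<lambda>u. 2 * pi * y * a u - b u) = 2 * pi * y * integral {-1..1} a - integral {-1..1} b"
    using int by (subst integral_diff) (auto intro: integrable_on_mult_right)
  ultimately show ?thesis unfolding costrans_def a_def b_def by simp
qed

lemma costrans_decay:
  obtains C where "C \<ge> 0" "\<And>y. \<bar>y\<bar> ^ N * \<bar>costrans (bump P n) \<alpha> y\<bar> \<le> C"
proof -
  have "\<exists>C. \<forall>y. \<bar>y\<bar> ^ N * \<bar>costrans (bump P n) \<alpha> y\<bar> \<le> C"
  proof (induction N arbitrary: P n \<alpha>)
    case 0
    obtain C where C: "C \<ge> 0" "\<And>x. \<bar>bump P n x\<bar> \<le> C" using bump_rapid[of P n] by metis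
    have "\<bar>costrans (bump P n) \<alpha> y\<bar> \<le> C * (1 - (-1))" for y
      unfolding costrans_def
    proof (rule integral_bound[where 'a=real, simplified real_norm_def])
      show "\<bar>bump P n u * cos (2 * pi * u * y + \<alpha>)\<bar> \<le> C" for u
        using mult_mono[OF C(2)[of u] abs_cos_le_one[of "2 * pi * u * y + \<alpha>"]] C(1) by (simp add: abs_mult)
    qed (auto intro!: continuous_intros)
    thus ?case by auto
  next
    case (Suc N)
    obtain C where C: "\<And>y. \<bar>y\<bar> ^ N * \<bar>costrans (bump (bump_deriv P n) (n + 2)) (\<alpha> + pi / 2) y\<bar> \<le> C"
      using Suc by blast
    have "\<bar>y\<bar> ^ Suc N * \<bar>costrans (bump P n) \<alpha> y\<bar> \<le> C / (2 * pi)" for y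
    proof -
      have "\<bar>y\<bar> ^ Suc N * \<bar>costrans (bump P n) \<alpha> y\<bar> =
         \<bar>y\<bar> ^ N * \<bar>2 * pi * y * costrans (bump P n) \<alpha> y\<bar> / (2 * pi)"
        by (simp add: abs_mult)
      also have "\<dots> \<le> C / (2 * pi)"
        unfolding costrans_by_parts by (intro divide_right_mono C) auto
      finally show ?thesis .
    qed
    thus ?case by blast
  qed
  then obtain C where "\<forall>y. \<bar>y\<bar> ^ N * \<bar>costrans (bump P n) \<alpha> y\<bar> \<le> C" by blast
  thus ?thesis using that[of "max C 0"] by (meson max.coboundedI1 max.cobounded2)
qed

lemma costrans_rapid:
  obtains C where "C \<ge> 0" "\<And>x. \<bar>costrans (bump P n) \<alpha> x\<bar> \<le> C / (1 + x\<^sup>2)"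
    "\<And>x. \<bar>costrans (bump P n) \<alpha> x\<bar> \<le> C"
proof -
  obtain C where C: "C \<ge> 0" "\<And>y. \<bar>y\<bar> ^ 0 * \<bar>costrans (bump P n) \<alpha> y\<bar> \<le> C"
    using costrans_decay by blast
  obtain D where D: "D \<ge> 0" "\<And>y. \<bar>y\<bar> ^ 2 * \<bar>costrans (bump P n) \<alpha> y\<bar> \<le> D"
    using costrans_decay by blast
  have "(1 + y\<^sup>2) * \<bar>costrans (bump P n) \<alpha> y\<bar> \<le> C + D" for y
    using C(2)[of y] D(2)[of y] by (simp add: algebra_simps)
  hence "\<bar>costrans (bump P n) \<alpha> y\<bar> \<le> (C + D) / (1 + y\<^sup>2)" for y
    by (simp add: pos_le_divide_eq add_pos_nonneg mult.commute)
  moreover have "\<bar>costrans (bump P n) \<alpha> y\<bar> \<le> C + D" for y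
    using C(2)[of y] D by simp
  ultimately show ?thesis using that[of "C + D"] C(1) D(1) by simp
qed

lemma costrans_0_minus: "costrans f 0 (- y) = costrans f 0 y"
  using cos_minus by (simp add: costrans_def)

section \<open>Euler-Maclaurin summation\<close>

text \<open>
  The integral over \<open>[-M, M]\<close> of the product of \<open>G\<close> and the 1-periodic extension of \<open>\<beta>\<close>, written as a
  sum over unit cells so that only the values of \<open>\<beta>\<close> on \<open>[0, 1]\<close> occur. With \<open>\<beta>\<close> a Bernoulli polynomial this
  is the remainder term of Euler-Maclaurin summation.
\<close>

definition cell_sum :: "(real \<Rightarrow> real) \<Rightarrow> nat \<Rightarrow> (real \<Rightarrow> real) \<Rightarrow> real" where
  "cell_sum \<beta> M G = (\<Sum>i<2 * M. integral {0..1} (\<lambda>t. \<beta> t * G (real i - real M + t)))"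

lemma telescope_cells: "(\<Sum>i<2 * M. A (real i - real M + 1) - A (real i - real M)) = A (real M) - A (- real M)"
  for A :: "real \<Rightarrow> real"
proof -
  have "(\<Sum>i<2 * M. A (real i - real M + 1) - A (real i - real M))
      = (\<Sum>i<2 * M. A (real (Suc i) - real M) - A (real i - real M))"
    by (intro sum.cong refl) (simp add: algebra_simps)
  also have "\<dots> = A (real (2 * M) - real M) - A (real 0 - real M)"
    by (rule sum_lessThan_telescope)
  finally show ?thesis by simp
qed

lemma sum_integral_cells:
  fixes G :: "real \<Rightarrow> real"
  assumes "continuous_on UNIV G"
  shows "(\<Sum>i<2 * M. integral {0..1} (\<lambda>t. G (real i - real M + t))) = integral {- real M..real M} G"
proof -
  obtain A where A: "\<And>t. t \<in> {- real M..real M} \<Longrightarrow> (A has_vector_derivative G t) (at t within {- real M..real M})"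
    using antiderivative_continuous[of "- real M" "real M" G] continuous_on_subset[OF assms] by blast
  have "integral {0..1} (\<lambda>t. G (real i - real M + t)) = A (real i - real M + 1) - A (real i - real M)"
    if "i < 2 * M" for i
  proof -
    define c where "c = real i - real M"
    have "real i + 1 \<le> 2 * real M" using that by linarith
    hence sub: "(\<lambda>t. c + t) ` {0..1} \<subseteq> {- real M..real M}" by (auto simp: c_def)
    have "((\<lambda>t. A (c + t)) has_vector_derivative G (c + t)) (at t within {0..1})" if "t \<in> {0..1}" for t
    proof -
      have "((\<lambda>t. c + t) has_real_derivative 1) (at t within {0..1})"
        by (auto intro!: derivative_eq_intros)
      hence "((\<lambda>t. c + t) has_vector_derivative 1) (at t within {0..1})"
        by (simp add: has_real_derivative_iff_has_vector_derivative)
      moreover have "(A has_vector_derivative G (c + t)) (at (c + t) within (\<lambda>t. c + t) ` {0..1})"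
        using has_vector_derivative_within_subset[OF A sub] sub that by blast
      ultimately have "(A \<circ> (\<lambda>t. c + t) has_vector_derivative (1 *\<^sub>R G (c + t))) (at t within {0..1})"
        by (rule vector_diff_chain_within)
      thus ?thesis by (simp add: o_def)
    qed
    hence "((\<lambda>t. G (c + t)) has_integral (A (c + 1) - A (c + 0))) {0..1}"
      by (intro fundamental_theorem_of_calculus) auto
    thus ?thesis by (simp add: c_def integral_unique)
  qed
  hence "(\<Sum>i<2 * M. integral {0..1} (\<lambda>t. G (real i - real M + t))) = A (real M) - A (- real M)"
    using telescope_cells[of A M] by simp
  also have "\<dots> = integral {- real M..real M} G"
    using fundamental_theorem_of_calculus[of "- real M" "real M" A G] A by (simp add: integral_unique)
  finally show ?thesis .
qed

lemma cell_sum_add: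
  assumes "continuous_on {0..1} \<beta>" "continuous_on UNIV G" "continuous_on UNIV H"
  shows "cell_sum \<beta> M (\<lambda>t. a * G t + b * H t) = a * cell_sum \<beta> M G + b * cell_sum \<beta> M H"
proof -
  have "integral {0..1} (\<lambda>t. \<beta> t * (a * G (c + t) + b * H (c + t)))
    = a * integral {0..1} (\<lambda>t. \<beta> t * G (c + t)) + b * integral {0..1} (\<lambda>t. \<beta> t * H (c + t))" for c
  proof -
    have 1: "(\<lambda>t. \<beta> t * G (c + t)) integrable_on {0..1}" "(\<lambda>t. \<beta> t * H (c + t)) integrable_on {0..1}"
      by (intro integrable_continuous_interval continuous_intros assms
          continuous_on_compose2[OF assms(2)] continuous_on_compose2[OF assms(3)] subset_UNIV)+
    have "integral {0..1} (\<lambda>t. \<beta> t * (a * G (c + t) + b * H (c + t)))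
      = integral {0..1} (\<lambda>t. a * (\<beta> t * G (c + t)) + b * (\<beta> t * H (c + t)))"
      by (simp add: algebra_simps)
    also have "\<dots> = integral {0..1} (\<lambda>t. a * (\<beta> t * G (c + t))) + integral {0..1} (\<lambda>t. b * (\<beta> t * H (c + t)))"
      by (rule integral_add) (use 1 in \<open>auto intro: integrable_on_mult_right\<close>)
    finally show ?thesis by simp
  qed
  thus ?thesis by (simp add: cell_sum_def sum.distrib sum_distrib_left)
qed

lemma cell_sum_by_parts:
  assumes \<beta>: "continuous_on {0..1} \<beta>"
    and \<gamma>: "\<And>t. t \<in> {0..1} \<Longrightarrow> (\<gamma> has_real_derivative \<beta> t) (at t within {0..1})" "\<gamma> 1 = \<gamma> 0"
    and G: "\<And>t. (G has_real_derivative G' t) (at t)" "continuous_on UNIV G'"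
    and per: "G (real M) = G (- real M)"
  shows "cell_sum \<beta> M G = - cell_sum \<gamma> M G'"
proof -
  have contG: "continuous_on UNIV G"
    by (rule DERIV_continuous_on, rule G(1))
  have cont\<gamma>: "continuous_on {0..1} \<gamma>"
    using \<gamma>(1) by (rule DERIV_continuous_on)
  have cell: "integral {0..1} (\<lambda>t. \<beta> t * G (c + t)) + integral {0..1} (\<lambda>t. \<gamma> t * G' (c + t))
      = \<gamma> 0 * (G (c + 1) - G c)" for c
  proof -
    have int: "(\<lambda>t. \<beta> t * G (c + t)) integrable_on {0..1}" "(\<lambda>t. \<gamma> t * G' (c + t)) integrable_on {0..1}"
      by (intro integrable_continuous_interval continuous_intros \<beta> cont\<gamma>
          continuous_on_compose2[OF contG] continuous_on_compose2[OF G(2)] subset_UNIV)+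
    have "((\<lambda>t. \<beta> t * G (c + t) + \<gamma> t * G' (c + t)) has_integral (\<gamma> 1 * G (c + 1) - \<gamma> 0 * G (c + 0))) {0..1}"
    proof (rule fundamental_theorem_of_calculus)
      fix t :: real assume t: "t \<in> {0..1}"
      have "((\<lambda>t. G (c + t)) has_real_derivative G' (c + t)) (at t within {0..1})"
        by (rule DERIV_chain2[of G "G' (c + t)" "\<lambda>t. c + t" t 1 "{0..1}", OF G(1), simplified])
          (auto intro!: derivative_eq_intros)
      from DERIV_mult[OF \<gamma>(1)[OF t] this]
      show "((\<lambda>t. \<gamma> t * G (c + t)) has_vector_derivative (\<beta> t * G (c + t) + \<gamma> t * G' (c + t))) (at t within {0..1})"
        by (simp add: has_real_derivative_iff_has_vector_derivative[symmetric] algebra_simps)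
    qed simp
    from integral_unique[OF this, unfolded integral_add[OF int]] show ?thesis
      using \<gamma>(2) by (simp add: field_simps)
  qed
  have "cell_sum \<beta> M G + cell_sum \<gamma> M G' = (\<Sum>i<2 * M. \<gamma> 0 * (G (real i - real M + 1) - G (real i - real M)))"
    by (simp add: cell_sum_def cell sum.distrib[symmetric])
  also have "\<dots> = \<gamma> 0 * (G (real M) - G (- real M))"
    by (simp add: sum_distrib_left[symmetric] telescope_cells)
  finally show ?thesis using per by simp
qed

lemma zero_mean_antiderivative:
  fixes \<beta> :: "real \<Rightarrow> real"
  assumes "continuous_on {0..1} \<beta>" "integral {0..1} \<beta> = 0"
  obtains \<gamma> where "\<And>t. t \<in> {0..1} \<Longrightarrow> (\<gamma> has_real_derivative \<beta> t) (at t within {0..1})"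
    "\<gamma> 1 = \<gamma> 0" "continuous_on {0..1} \<gamma>" "integral {0..1} \<gamma> = 0"
proof -
  obtain A where A: "\<And>t. t \<in> {0..1} \<Longrightarrow> (A has_real_derivative \<beta> t) (at t within {0..1})"
    using antiderivative_continuous[of 0 1 \<beta>] assms
    by (auto simp: has_real_derivative_iff_has_vector_derivative)
  define \<gamma> where "\<gamma> t = A t - integral {0..1} A" for t
  have "(\<beta> has_integral A 1 - A 0) {0..1}"
    using A by (intro fundamental_theorem_of_calculus) (auto simp: has_real_derivative_iff_has_vector_derivative)
  hence A10: "A 1 = A 0" using assms(2) by (simp add: integral_unique)
  have contA: "continuous_on {0..1} A" using A by (rule DERIV_continuous_on)
  show ?thesis
  proof (rule that[of \<gamma>])
    show "(\<gamma> has_real_derivative \<beta> t) (at t within {0..1})" if "t \<in> {0..1}" for t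
      unfolding \<gamma>_def[abs_def] using A[OF that] by (auto intro!: derivative_eq_intros)
    show "\<gamma> 1 = \<gamma> 0" by (simp add: \<gamma>_def A10)
    show "continuous_on {0..1} \<gamma>" unfolding \<gamma>_def[abs_def] by (intro continuous_intros contA)
    show "integral {0..1} \<gamma> = 0" unfolding \<gamma>_def[abs_def]
      by (subst integral_diff) (auto intro: integrable_continuous_interval contA)
  qed
qed

lemma sum_minus_integral_eq_cell_sum:
  assumes G: "\<And>t. (G has_real_derivative G' t) (at t)" "continuous_on UNIV G'"
    and per: "G (real M) = G (- real M)"
  shows "(\<Sum>i<2 * M. G (real i - real M)) - integral {- real M..real M} G = cell_sum (\<lambda>t. t - 1 / 2) M G'"
proof -
  have contG: "continuous_on UNIV G"
    by (rule DERIV_continuous_on, rule G(1))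
  have cell: "integral {0..1} (\<lambda>t. (t - 1 / 2) * G' (c + t)) + integral {0..1} (\<lambda>t. G (c + t))
      = G c + (G (c + 1) - G c) / 2" for c
  proof -
    have int: "(\<lambda>t. (t - 1 / 2) * G' (c + t)) integrable_on {0..1}" "(\<lambda>t. G (c + t)) integrable_on {0..1}"
      by (intro integrable_continuous_interval continuous_intros
          continuous_on_compose2[OF contG] continuous_on_compose2[OF G(2)] subset_UNIV)+
    have "((\<lambda>t. (t - 1 / 2) * G' (c + t) + G (c + t)) has_integral
        ((1 - 1 / 2) * G (c + 1) - (0 - 1 / 2) * G (c + 0))) {0..1}"
    proof (rule fundamental_theorem_of_calculus)
      fix t :: real
      have "((\<lambda>t. G (c + t)) has_real_derivative G' (c + t)) (at t within {0..1})"
        by (rule DERIV_chain2[of G "G' (c + t)" "\<lambda>t. c + t" t 1 "{0..1}", OF G(1), simplified])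
          (auto intro!: derivative_eq_intros)
      moreover have "((\<lambda>t. t - 1 / 2) has_real_derivative 1) (at t within {0..1})"
        by (auto intro!: derivative_eq_intros)
      ultimately have "((\<lambda>t. (t - 1 / 2) * G (c + t)) has_real_derivative
          (1 * G (c + t) + G' (c + t) * (t - 1 / 2))) (at t within {0..1})"
        by (intro DERIV_mult)
      thus "((\<lambda>t. (t - 1 / 2) * G (c + t)) has_vector_derivative
          ((t - 1 / 2) * G' (c + t) + G (c + t))) (at t within {0..1})"
        by (simp add: has_real_derivative_iff_has_vector_derivative[symmetric] algebra_simps)
    qed simp
    from integral_unique[OF this, unfolded integral_add[OF int]] show ?thesis
      by (simp add: field_simps)
  qed
  have "cell_sum (\<lambda>t. t - 1 / 2) M G' + integral {- real M..real M} G
    = (\<Sum>i<2 * M. G (real i - real M) + (G (real i - real M + 1) - G (real i - real M)) / 2)"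
    unfolding sum_integral_cells[OF contG, symmetric]
    by (simp only: cell_sum_def cell sum.distrib[symmetric])
  also have "\<dots> = (\<Sum>i<2 * M. G (real i - real M)) + (G (real M) - G (- real M)) / 2"
    by (simp only: sum.distrib sum_divide_distrib[symmetric] telescope_cells)
  finally show ?thesis using per by simp
qed

lemma cell_sum_le:
  assumes \<beta>: "continuous_on {0..1} \<beta>" "\<And>t. t \<in> {0..1} \<Longrightarrow> \<bar>\<beta> t\<bar> \<le> B"
    and G: "continuous_on UNIV G" "\<And>t. \<bar>G t\<bar> \<le> C / (1 + (s * t)\<^sup>2)" and s: "s > 0" and C: "C \<ge> 0"
  shows "\<bar>cell_sum \<beta> M G\<bar> \<le> B * C * pi / s"
proof -
  define A where "A t = B * C / s * arctan (s * t)" for t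
  have B0: "B \<ge> 0" using \<beta>(2)[of 0] by auto
  have "\<bar>integral {0..1} (\<lambda>t. \<beta> t * G (c + t))\<bar> \<le> A (c + 1) - A c" for c
  proof -
    have hi: "((\<lambda>t. B * (C / (1 + (s * (c + t))\<^sup>2))) has_integral A (c + 1) - A (c + 0)) {0..1}"
    proof (rule fundamental_theorem_of_calculus)
      fix t :: real
      have "((\<lambda>t. A (c + t)) has_real_derivative B * (C / (1 + (s * (c + t))\<^sup>2))) (at t within {0..1})"
        unfolding A_def by (rule derivative_eq_intros refl)+ (use s in \<open>simp add: divide_inverse\<close>)
      thus "((\<lambda>t. A (c + t)) has_vector_derivative B * (C / (1 + (s * (c + t))\<^sup>2))) (at t within {0..1})"
        by (simp add: has_real_derivative_iff_has_vector_derivative)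
    qed simp
    have "norm (integral {0..1} (\<lambda>t. \<beta> t * G (c + t))) \<le> integral {0..1} (\<lambda>t. B * (C / (1 + (s * (c + t))\<^sup>2)))"
    proof (rule integral_norm_bound_integral)
      show "(\<lambda>t. \<beta> t * G (c + t)) integrable_on {0..1}"
        by (intro integrable_continuous_interval continuous_intros \<beta>
          continuous_on_compose2[OF G(1)] subset_UNIV)
      show "norm (\<beta> t * G (c + t)) \<le> B * (C / (1 + (s * (c + t))\<^sup>2))" if "t \<in> {0..1}" for t
        using mult_mono[OF \<beta>(2)[OF that] G(2)[of "c + t"]] B0 by (simp add: abs_mult)
    qed (use hi in blast)
    thus ?thesis using hi by (simp add: integral_unique)
  qed
  hence "\<bar>cell_sum \<beta> M G\<bar> \<le> (\<Sum>i<2 * M. A (real i - real M + 1) - A (real i - real M))"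
    unfolding cell_sum_def by (intro order_trans[OF sum_abs] sum_mono)
  also have "\<dots> = B * C / s * (arctan (s * real M) - arctan (s * (- real M)))"
    unfolding telescope_cells by (simp add: A_def algebra_simps)
  also have "\<dots> \<le> B * C / s * pi"
  proof (intro mult_left_mono)
    show "arctan (s * real M) - arctan (s * (- real M)) \<le> pi"
      using arctan_ubound[of "s * real M"] by (simp add: arctan_minus)
  qed (use B0 C s in auto)
  finally show ?thesis by simp
qed

lemma product_rapid:
  obtains C where "C \<ge> 0" "\<And>x y t. x > 0 \<Longrightarrow> \<bar>bump P n (x * t) * costrans (bump R m) \<alpha> (y * t)\<bar>
      \<le> C / (1 + (max x \<bar>y\<bar> * t)\<^sup>2)"
proof -
  obtain A where A: "A \<ge> 0" "\<And>x. \<bar>bump P n x\<bar> \<le> A / (1 + x\<^sup>2)" "\<And>x. \<bar>bump P n x\<bar> \<le> A"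
    using bump_rapid[of P n] by blast
  obtain B where B: "B \<ge> 0" "\<And>x. \<bar>costrans (bump R m) \<alpha> x\<bar> \<le> B / (1 + x\<^sup>2)"
      "\<And>x. \<bar>costrans (bump R m) \<alpha> x\<bar> \<le> B"
    using costrans_rapid[of R m \<alpha>] by blast
  have "\<bar>bump P n (x * t) * costrans (bump R m) \<alpha> (y * t)\<bar> \<le> A * B / (1 + (max x \<bar>y\<bar> * t)\<^sup>2)"
    if "x > 0" for x y t
  proof (cases "\<bar>y\<bar> \<le> x")
    case True
    thus ?thesis using mult_mono[OF A(2)[of "x * t"] B(3)[of "y * t"]] A(1) B(1)
      by (simp add: abs_mult max_def)
  next
    case False
    thus ?thesis using mult_mono[OF A(3)[of "x * t"] B(2)[of "y * t"]] A(1) B(1)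
      by (simp add: abs_mult max_def power_mult_distrib)
  qed
  thus ?thesis using that[of "A * B"] A(1) B(1) by simp
qed

lemma bump_endpoint_eq_0:
  assumes "1 \<le> real M * x"
  shows "bump P n (x * real M) = 0" "bump P n (- (x * real M)) = 0"
  using assms by (auto intro!: bump_eq_0 simp: mult.commute)

lemma has_real_derivative_product:
  "((\<lambda>t. bump P n (x * t) * costrans (bump R m) \<alpha> (y * t)) has_real_derivative
     x * (bump (bump_deriv P n) (n + 2) (x * t) * costrans (bump R m) \<alpha> (y * t)) +
     y * (bump P n (x * t) * costrans (bump (smult (2 * pi) (pCons 0 R)) m) (\<alpha> + pi / 2) (y * t))) (at t)"
proof -
  have l: "((\<lambda>t. a * t) has_real_derivative a) (at t)" for a :: real
    using DERIV_cmult_Id by simp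
  show ?thesis
    using DERIV_mult[OF DERIV_chain2[OF has_real_derivative_bump[of P n "x * t"] l]
        DERIV_chain2[OF has_real_derivative_costrans[of R m \<alpha> "y * t"] l]]
    by (simp add: algebra_simps)
qed

text \<open>
  Each integration by parts replaces \<open>\<beta>\<close> by a zero-mean antiderivative and gains a factor of size
  \<open>max x \<bar>y\<bar>\<close> from differentiating the product. Since the claim is made for all \<open>\<beta>\<close> and for all members of the two families at
  once, the induction needs no formula for higher derivatives of a product.
\<close>

lemma cell_sum_product_le:
  assumes "continuous_on {0..1} \<beta>" "integral {0..1} \<beta> = 0"
  shows "\<exists>C\<ge>0. \<forall>x y M. x > 0 \<and> 1 \<le> real M * x \<longrightarrow>
    \<bar>cell_sum \<beta> M (\<lambda>t. bump P n (x * t) * costrans (bump R m) \<alpha> (y * t))\<bar> \<le> C * (max x \<bar>y\<bar> ^ N / max x \<bar>y\<bar>)"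
  using assms
proof (induction N arbitrary: \<beta> P n R m \<alpha>)
  case 0
  obtain C where C: "C \<ge> 0" "\<And>x y t. x > 0 \<Longrightarrow> \<bar>bump P n (x * t) * costrans (bump R m) \<alpha> (y * t)\<bar>
      \<le> C / (1 + (max x \<bar>y\<bar> * t)\<^sup>2)"
    using product_rapid[of P n R m \<alpha>] by blast
  have "bounded (\<beta> ` {0..1})"
    using 0 by (intro compact_imp_bounded compact_continuous_image) auto
  then obtain B where B: "\<And>t. t \<in> {0..1} \<Longrightarrow> \<bar>\<beta> t\<bar> \<le> B"
    unfolding bounded_iff by (metis imageI real_norm_def)
  have B0: "B \<ge> 0" using B[of 0] by auto
  have "\<bar>cell_sum \<beta> M (\<lambda>t. bump P n (x * t) * costrans (bump R m) \<alpha> (y * t))\<bar> \<le> B * C * pi / max x \<bar>y\<bar>"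
    if "x > 0" for x y M
    by (rule cell_sum_le) (use that 0 B C in \<open>auto intro!: continuous_intros\<close>)
  thus ?case using B0 C(1) by (intro exI[of _ "B * C * pi"]) auto
next
  case (Suc N)
  obtain \<gamma> where \<gamma>: "\<And>t. t \<in> {0..1} \<Longrightarrow> (\<gamma> has_real_derivative \<beta> t) (at t within {0..1})"
    "\<gamma> 1 = \<gamma> 0" "continuous_on {0..1} \<gamma>" "integral {0..1} \<gamma> = 0"
    using zero_mean_antiderivative[OF Suc.prems] by metis
  define G where "G x y t = bump P n (x * t) * costrans (bump R m) \<alpha> (y * t)" for x y t
  define G1 where "G1 x y t = bump (bump_deriv P n) (n + 2) (x * t) * costrans (bump R m) \<alpha> (y * t)" for x y t
  define G2 where "G2 x y t = bump P n (x * t) * costrans (bump (smult (2 * pi) (pCons 0 R)) m) (\<alpha> + pi / 2) (y * t)"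
    for x y t
  obtain C1 where C1: "C1 \<ge> 0" "\<And>x y M. x > 0 \<and> 1 \<le> real M * x \<Longrightarrow>
      \<bar>cell_sum \<gamma> M (G1 x y)\<bar> \<le> C1 * (max x \<bar>y\<bar> ^ N / max x \<bar>y\<bar>)"
    using Suc.IH[OF \<gamma>(3,4)] unfolding G1_def by blast
  obtain C2 where C2: "C2 \<ge> 0" "\<And>x y M. x > 0 \<and> 1 \<le> real M * x \<Longrightarrow>
      \<bar>cell_sum \<gamma> M (G2 x y)\<bar> \<le> C2 * (max x \<bar>y\<bar> ^ N / max x \<bar>y\<bar>)"
    using Suc.IH[OF \<gamma>(3,4)] unfolding G2_def by blast
  have "\<bar>cell_sum \<beta> M (G x y)\<bar> \<le> (C1 + C2) * (max x \<bar>y\<bar> ^ Suc N / max x \<bar>y\<bar>)"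
    if xM: "x > 0 \<and> 1 \<le> real M * x" for x y M
  proof -
    define s where "s = max x \<bar>y\<bar>"
    have s: "s > 0" "x \<le> s" "\<bar>y\<bar> \<le> s" using xM by (auto simp: s_def)
    have "cell_sum \<beta> M (G x y) = - cell_sum \<gamma> M (\<lambda>t. x * G1 x y t + y * G2 x y t)"
    proof (rule cell_sum_by_parts[OF Suc.prems(1) \<gamma>(1,2)])
      show "(G x y has_real_derivative x * G1 x y t + y * G2 x y t) (at t)" for t
        unfolding G_def[abs_def] G1_def G2_def by (rule has_real_derivative_product)
    qed (use xM in \<open>auto simp: G_def[abs_def] G1_def G2_def bump_endpoint_eq_0 intro!: continuous_intros\<close>)
    also have "cell_sum \<gamma> M (\<lambda>t. x * G1 x y t + y * G2 x y t) = x * cell_sum \<gamma> M (G1 x y) + y * cell_sum \<gamma> M (G2 x y)"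
      by (rule cell_sum_add) (auto simp: G1_def[abs_def] G2_def[abs_def] \<gamma> intro!: continuous_intros)
    finally have "\<bar>cell_sum \<beta> M (G x y)\<bar> \<le> \<bar>x\<bar> * \<bar>cell_sum \<gamma> M (G1 x y)\<bar> + \<bar>y\<bar> * \<bar>cell_sum \<gamma> M (G2 x y)\<bar>"
      by (simp add: abs_mult[symmetric] del: abs_mult)
    also have "\<dots> \<le> s * (C1 * (s ^ N / s)) + s * (C2 * (s ^ N / s))"
      using C1(2)[OF xM, of y] C2(2)[OF xM, of y] s xM
      by (intro add_mono mult_mono) (auto simp: s_def[symmetric])
    also have "\<dots> = (C1 + C2) * (s ^ Suc N / s)" using s by (simp add: field_simps)
    finally show ?thesis by (simp add: s_def)
  qed
  thus ?case using C1(1) C2(1) unfolding G_def by (intro exI[of _ "C1 + C2"]) auto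
qed

text \<open>
  Sums over the integers approximate integrals to arbitrary order. The bound also holds for \<open>N = 0\<close>, where it
  is uniform in \<open>x\<close> and \<open>y\<close>.
\<close>

lemma sum_product_approx_integral:
  obtains C where "C \<ge> 0" "\<And>x y M. x > 0 \<Longrightarrow> 1 \<le> real M * x \<Longrightarrow>
    \<bar>(\<Sum>i<2 * M. bump P n (x * (real i - real M)) * costrans (bump R m) \<alpha> (y * (real i - real M)))
      - integral {- real M..real M} (\<lambda>t. bump P n (x * t) * costrans (bump R m) \<alpha> (y * t))\<bar>
    \<le> C * max x \<bar>y\<bar> ^ N"
proof -
  \<comment> \<open>The first Bernoulli polynomial.\<close>
  let ?\<beta> = "\<lambda>t :: real. t - 1 / 2"
  have \<beta>: "continuous_on {0..1} ?\<beta>" "integral {0..1} ?\<beta> = 0"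
  proof -
    have "(?\<beta> has_integral ((1\<^sup>2 / 2 - 1 / 2) - (0\<^sup>2 / 2 - 0 / 2))) {0..1}"
      by (rule fundamental_theorem_of_calculus)
        (auto simp: has_real_derivative_iff_has_vector_derivative[symmetric] intro!: derivative_eq_intros)
    thus "integral {0..1} ?\<beta> = 0" by (simp add: integral_unique)
  qed (intro continuous_intros)
  define G where "G x y t = bump P n (x * t) * costrans (bump R m) \<alpha> (y * t)" for x y t
  define G1 where "G1 x y t = bump (bump_deriv P n) (n + 2) (x * t) * costrans (bump R m) \<alpha> (y * t)" for x y t
  define G2 where "G2 x y t = bump P n (x * t) * costrans (bump (smult (2 * pi) (pCons 0 R)) m) (\<alpha> + pi / 2) (y * t)"
    for x y t
  obtain C1 where C1: "C1 \<ge> 0" "\<And>x y M. x > 0 \<and> 1 \<le> real M * x \<Longrightarrow>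
      \<bar>cell_sum ?\<beta> M (G1 x y)\<bar> \<le> C1 * (max x \<bar>y\<bar> ^ N / max x \<bar>y\<bar>)"
    using cell_sum_product_le[OF \<beta>] unfolding G1_def by blast
  obtain C2 where C2: "C2 \<ge> 0" "\<And>x y M. x > 0 \<and> 1 \<le> real M * x \<Longrightarrow>
      \<bar>cell_sum ?\<beta> M (G2 x y)\<bar> \<le> C2 * (max x \<bar>y\<bar> ^ N / max x \<bar>y\<bar>)"
    using cell_sum_product_le[OF \<beta>] unfolding G2_def by blast
  have "\<bar>(\<Sum>i<2 * M. G x y (real i - real M)) - integral {- real M..real M} (G x y)\<bar> \<le> (C1 + C2) * max x \<bar>y\<bar> ^ N"
    if xM: "x > 0 \<and> 1 \<le> real M * x" for x y M
  proof -
    define s where "s = max x \<bar>y\<bar>"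
    have s: "s > 0" "x \<le> s" "\<bar>y\<bar> \<le> s" using xM by (auto simp: s_def)
    have "(\<Sum>i<2 * M. G x y (real i - real M)) - integral {- real M..real M} (G x y)
        = cell_sum ?\<beta> M (\<lambda>t. x * G1 x y t + y * G2 x y t)"
    proof (rule sum_minus_integral_eq_cell_sum)
      show "(G x y has_real_derivative x * G1 x y t + y * G2 x y t) (at t)" for t
        unfolding G_def[abs_def] G1_def G2_def by (rule has_real_derivative_product)
    qed (use xM in \<open>auto simp: G_def[abs_def] G1_def G2_def bump_endpoint_eq_0 intro!: continuous_intros\<close>)
    also have "cell_sum ?\<beta> M (\<lambda>t. x * G1 x y t + y * G2 x y t) = x * cell_sum ?\<beta> M (G1 x y) + y * cell_sum ?\<beta> M (G2 x y)"
      by (rule cell_sum_add) (auto simp: G1_def[abs_def] G2_def[abs_def] intro!: continuous_intros)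
    finally have "\<bar>(\<Sum>i<2 * M. G x y (real i - real M)) - integral {- real M..real M} (G x y)\<bar>
        \<le> \<bar>x\<bar> * \<bar>cell_sum ?\<beta> M (G1 x y)\<bar> + \<bar>y\<bar> * \<bar>cell_sum ?\<beta> M (G2 x y)\<bar>"
      by (simp add: abs_mult[symmetric] del: abs_mult)
    also have "\<dots> \<le> s * (C1 * (s ^ N / s)) + s * (C2 * (s ^ N / s))"
      using C1(2)[OF xM, of y] C2(2)[OF xM, of y] s xM
      by (intro add_mono mult_mono) (auto simp: s_def[symmetric])
    also have "\<dots> = (C1 + C2) * s ^ N" using s by (simp add: field_simps)
    finally show ?thesis by (simp add: s_def)
  qed
  thus ?thesis using that[of "C1 + C2"] C1(1) C2(1) unfolding G_def by auto
qed

section \<open>Fourier inversion\<close>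

lemma integrable_bump_mult:
  fixes h :: "real \<Rightarrow> complex"
  assumes "continuous_on UNIV h"
  shows "integrable lborel (\<lambda>u. of_real (bump P n u) * h u)"
proof -
  have "integrable lborel (\<lambda>u. indicator {-1..1} u *\<^sub>R (of_real (bump P n u) * h u))"
    by (rule borel_integrable_compact) (auto intro!: continuous_intros continuous_on_subset[OF assms])
  also have "(\<lambda>u. indicator {-1..1} u *\<^sub>R (of_real (bump P n u) * h u)) = (\<lambda>u. of_real (bump P n u) * h u)"
  proof
    fix u :: real
    show "indicator {-1..1} u *\<^sub>R (of_real (bump P n u) * h u) = of_real (bump P n u) * h u"
      using bump_eq_0[of u P n] by (auto simp: indicator_def)
  qed
  finally show ?thesis .
qed

lemma integral_eq_lborel_of_support:
  fixes h :: "real \<Rightarrow> real"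
  assumes "continuous_on UNIV h" "\<And>u. \<bar>u\<bar> \<ge> R \<Longrightarrow> h u = 0"
  shows "integral {-R..R} h = (LINT u|lborel. h u)"
proof -
  have "integral {-R..R} h = (LINT u:{-R..R}|lborel. h u)"
    by (intro set_borel_integral_eq_integral(2)[symmetric] borel_integrable_atLeastAtMost'
        continuous_on_subset[OF assms(1)]) auto
  also have "\<dots> = (LINT u|lborel. h u)"
    unfolding set_lebesgue_integral_def
  proof (intro Bochner_Integration.integral_cong refl)
    show "indicator {-R..R} u *\<^sub>R h u = h u" for u
      using assms(2)[of u] by (cases "u \<in> {-R..R}") auto
  qed
  finally show ?thesis .
qed

lemma measurable_bump [measurable]: "bump P n \<in> borel_measurable borel"
  by (intro borel_measurable_continuous_onI continuous_intros)

lemma measurable_costrans [measurable]: "costrans (bump P n) \<alpha> \<in> borel_measurable borel"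
  by (intro borel_measurable_continuous_onI continuous_intros)

lemma costrans_eq_lebesgue:
  assumes even: "\<And>u. bump P n (- u) = bump P n u"
  shows "of_real (costrans (bump P n) 0 y) = (LINT u|lborel. of_real (bump P n u) * iexp (- (2 * pi * y * u)))"
proof -
  let ?c = "\<lambda>u. bump P n u * cos (2 * pi * y * u)" and ?s = "\<lambda>u. bump P n u * sin (2 * pi * y * u)"
  have int: "integrable lborel ?c" "integrable lborel ?s"
    using integrable_bump_mult[of "\<lambda>u. of_real (cos (2 * pi * y * u))" P n]
      integrable_bump_mult[of "\<lambda>u. of_real (sin (2 * pi * y * u))" P n]
    by (auto simp: of_real_mult[symmetric] complex_of_real_integrable_eq continuous_intros simp del: of_real_mult)
  \<comment> \<open>The sine part vanishes by parity.\<close>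
  have "(LINT u|lborel. ?s u) = (LINT u|lborel. ?s (- u))"
    using lborel_integral_real_affine[of "-1" ?s 0] by simp
  hence s0: "(LINT u|lborel. ?s u) = 0" by (simp add: even)
  have "integral {-1..1} ?c = (LINT u|lborel. ?c u)"
    by (rule integral_eq_lborel_of_support) (auto intro!: continuous_intros bump_eq_0)
  hence c: "(LINT u|lborel. ?c u) = costrans (bump P n) 0 y"
    by (simp add: costrans_def mult_ac)
  have iexp: "iexp (- (2 * pi * y * u)) = of_real (cos (2 * pi * y * u)) - \<i> * of_real (sin (2 * pi * y * u))" for u
    by (simp only: cis_conv_exp[symmetric]) (simp add: complex_eq_iff)
  have "(LINT u|lborel. of_real (bump P n u) * iexp (- (2 * pi * y * u)))
      = (LINT u|lborel. complex_of_real (?c u) - \<i> * complex_of_real (?s u))"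
    by (intro Bochner_Integration.integral_cong refl)
      (simp only: iexp of_real_mult, simp add: algebra_simps)
  also have "\<dots> = of_real (LINT u|lborel. ?c u) - \<i> * of_real (LINT u|lborel. ?s u)"
  proof (subst Bochner_Integration.integral_diff)
    show "integrable lborel (\<lambda>u. complex_of_real (?c u))"
      using int(1) by (simp only: complex_of_real_integrable_eq)
    show "integrable lborel (\<lambda>u. \<i> * complex_of_real (?s u))"
      using int(2) by (intro integrable_mult_right) (simp only: complex_of_real_integrable_eq)
  qed (simp only: integral_mult_right_zero integral_complex_of_real)
  finally show ?thesis by (simp add: c s0)
qed

lemma integrable_rapid: "integrable lborel (\<lambda>y::real. C / (1 + y\<^sup>2))"
proof -
  have "integrable lborel (\<lambda>x::real. inverse (1 + x\<^sup>2))"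
    using integrable_inverse_1_plus_square by (simp add: set_integrable_def)
  thus ?thesis by (simp add: divide_inverse)
qed

lemma integrable_costrans_mult:
  fixes h :: "real \<Rightarrow> complex"
  assumes [measurable]: "h \<in> borel_measurable borel" and h: "\<And>y. norm (h y) \<le> 1"
  shows "integrable lborel (\<lambda>y. of_real (costrans (bump P n) \<alpha> y) * h y)"
proof -
  obtain C where C: "C \<ge> 0" "\<And>x. \<bar>costrans (bump P n) \<alpha> x\<bar> \<le> C / (1 + x\<^sup>2)"
    using costrans_rapid by blast
  show ?thesis
  proof (rule Bochner_Integration.integrable_bound[OF integrable_rapid[of C]])
    show "AE y in lborel. norm (of_real (costrans (bump P n) \<alpha> y) * h y) \<le> norm (C / (1 + y\<^sup>2))"
    proof (intro always_eventually allI)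
      fix y
      have "norm (of_real (costrans (bump P n) \<alpha> y) * h y) \<le> C / (1 + y\<^sup>2) * 1"
        unfolding norm_mult norm_of_real by (intro mult_mono C(2) h) (use C(1) in auto)
      thus "norm (of_real (costrans (bump P n) \<alpha> y) * h y) \<le> norm (C / (1 + y\<^sup>2))" using C(1) by simp
    qed
  qed measurable
qed

lemma std_normal_fourier:
  "(LINT v|lborel. of_real (std_normal_density v) * iexp (x * v)) = of_real (exp (- x\<^sup>2 / 2))"
proof -
  have "char std_normal_distribution x = (LINT v|lborel. std_normal_density v *\<^sub>R iexp (x * v))"
    unfolding char_def by (subst integral_density) (auto)
  thus ?thesis
    using fun_cong[OF char_std_normal_distribution, of x] by (simp add: scaleR_conv_of_real)
qed

lemma gaussian_fourier:
  assumes "\<sigma> > 0"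
  shows "(LINT y|lborel. iexp (x * y) * of_real (exp (- (\<sigma> * y)\<^sup>2 / 2)))
    = of_real (sqrt (2 * pi) / \<sigma> * exp (- (x / \<sigma>)\<^sup>2 / 2))"
proof -
  have "(LINT y|lborel. iexp (x * y) * of_real (exp (- (\<sigma> * y)\<^sup>2 / 2)))
    = \<bar>1 / \<sigma>\<bar> *\<^sub>R (LINT v|lborel. iexp (x * (0 + 1 / \<sigma> * v)) * of_real (exp (- (\<sigma> * (0 + 1 / \<sigma> * v))\<^sup>2 / 2)))"
    using assms by (intro lborel_integral_real_affine) simp
  also have "(LINT v|lborel. iexp (x * (0 + 1 / \<sigma> * v)) * of_real (exp (- (\<sigma> * (0 + 1 / \<sigma> * v))\<^sup>2 / 2)))
    = (LINT v|lborel. of_real (sqrt (2 * pi)) * (of_real (std_normal_density v) * iexp (x / \<sigma> * v)))"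
    using assms by (intro Bochner_Integration.integral_cong refl) (simp add: std_normal_density_def)
  also have "\<dots> = of_real (sqrt (2 * pi)) * of_real (exp (- (x / \<sigma>)\<^sup>2 / 2))"
    unfolding integral_mult_right_zero std_normal_fourier ..
  finally show ?thesis using assms by (simp add: scaleR_conv_of_real)
qed

lemma integrable_gaussian:
  fixes \<sigma> :: real
  assumes "\<sigma> > 0"
  shows "integrable lborel (\<lambda>y. exp (- (\<sigma> * y)\<^sup>2 / 2))"
proof -
  have "integrable lborel (\<lambda>v. sqrt (2 * pi) * std_normal_density v)"
    by (intro integrable_mult_right) simp
  hence "integrable lborel (\<lambda>v::real. exp (- v\<^sup>2 / 2))"
    by (simp add: std_normal_density_def)
  from lborel_integrable_real_affine[OF this, of \<sigma> 0] show ?thesis using assms by simp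
qed

text \<open>
  The regularised inverse transform is the average of the bump over a normal distribution centred at \<open>t\<close>.
\<close>

lemma gaussian_mean:
  assumes even: "\<And>u. bump P n (- u) = bump P n u" and s: "\<sigma> > 0"
  shows "(LINT y|lborel. of_real (costrans (bump P n) 0 y) * iexp (2 * pi * t * y) * of_real (exp (- (\<sigma> * y)\<^sup>2 / 2)))
     = of_real (LINT v|lborel. std_normal_density v * bump P n (t + \<sigma> / (2 * pi) * v))"
proof -
  define f where "f u y = of_real (bump P n u) * (iexp (2 * pi * (t - u) * y) * of_real (exp (- (\<sigma> * y)\<^sup>2 / 2)))"
    for u y :: real
  have int: "integrable (lborel \<Otimes>\<^sub>M lborel) (case_prod f)"
  proof (rule lborel_pair.Fubini_integrable)
    show "case_prod f \<in> borel_measurable (lborel \<Otimes>\<^sub>M lborel)"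
      unfolding f_def by measurable
    have *: "integrable lborel (\<lambda>u. \<bar>bump P n u\<bar> * (LINT y|lborel. exp (- (\<sigma> * y)\<^sup>2 / 2)))"
      using integrable_norm[OF integrable_bump_mult[of "\<lambda>_. 1" P n]] by (intro integrable_mult_left) simp
    show "integrable lborel (\<lambda>u. LINT y|lborel. norm (case (u, y) of (u, y) \<Rightarrow> f u y))"
      using * by (simp add: f_def norm_mult)
    show "AE u in lborel. integrable lborel (\<lambda>y. case (u, y) of (u, y) \<Rightarrow> f u y)"
    proof (intro always_eventually allI)
      fix u
      show "integrable lborel (\<lambda>y. case (u, y) of (u, y) \<Rightarrow> f u y)"
      proof (rule Bochner_Integration.integrable_bound)
        show "integrable lborel (\<lambda>y. \<bar>bump P n u\<bar> * exp (- (\<sigma> * y)\<^sup>2 / 2))"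
          using integrable_gaussian[OF s] by (intro integrable_mult_right)
        show "(\<lambda>y. case (u, y) of (u, y) \<Rightarrow> f u y) \<in> borel_measurable lborel"
          unfolding f_def prod.case by measurable
      qed (auto simp: f_def norm_mult)
    qed
  qed
  have "(LINT y|lborel. of_real (costrans (bump P n) 0 y) * iexp (2 * pi * t * y) * of_real (exp (- (\<sigma> * y)\<^sup>2 / 2)))
      = (LINT y|lborel. LINT u|lborel. f u y)"
  proof (intro Bochner_Integration.integral_cong refl)
    fix y :: real
    have "iexp (- (2 * pi * y * u)) * iexp (2 * pi * t * y) = iexp (2 * pi * (t - u) * y)" for u
      by (simp add: exp_add[symmetric] algebra_simps)
    hence *: "of_real (bump P n u) * iexp (- (2 * pi * y * u)) * (iexp (2 * pi * t * y) * of_real (exp (- (\<sigma> * y)\<^sup>2 / 2)))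
       = f u y" for u
      unfolding f_def by (metis (no_types, lifting) mult.assoc)
    show "of_real (costrans (bump P n) 0 y) * iexp (2 * pi * t * y) * of_real (exp (- (\<sigma> * y)\<^sup>2 / 2))
      = (LINT u|lborel. f u y)"
      unfolding costrans_eq_lebesgue[OF even] mult.assoc[of _ "iexp (2 * pi * t * y)"]
        integral_mult_left_zero[symmetric] * ..
  qed
  also have "\<dots> = (LINT u|lborel. LINT y|lborel. f u y)"
    by (rule lborel_pair.Fubini_integral[OF int])
  also have "\<dots> = (LINT u|lborel. of_real (bump P n u * (sqrt (2 * pi) / \<sigma> * exp (- (2 * pi * (t - u) / \<sigma>)\<^sup>2 / 2))))"
    unfolding f_def integral_mult_right_zero gaussian_fourier[OF s] by simp
  also have "\<dots> = of_real (LINT u|lborel. bump P n u * (sqrt (2 * pi) / \<sigma> * exp (- (2 * pi * (t - u) / \<sigma>)\<^sup>2 / 2)))"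
    by (rule integral_complex_of_real)
  also have "(LINT u|lborel. bump P n u * (sqrt (2 * pi) / \<sigma> * exp (- (2 * pi * (t - u) / \<sigma>)\<^sup>2 / 2)))
     = \<bar>\<sigma> / (2 * pi)\<bar> *\<^sub>R (LINT v|lborel. bump P n (t + \<sigma> / (2 * pi) * v) *
         (sqrt (2 * pi) / \<sigma> * exp (- (2 * pi * (t - (t + \<sigma> / (2 * pi) * v)) / \<sigma>)\<^sup>2 / 2)))"
    using s by (intro lborel_integral_real_affine) simp
  also have "\<dots> = (LINT v|lborel. \<sigma> / (2 * pi) * (bump P n (t + \<sigma> / (2 * pi) * v) *
         (sqrt (2 * pi) / \<sigma> * exp (- (2 * pi * (t - (t + \<sigma> / (2 * pi) * v)) / \<sigma>)\<^sup>2 / 2))))"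
    using s by simp
  also have "\<dots> = (LINT v|lborel. std_normal_density v * bump P n (t + \<sigma> / (2 * pi) * v))"
  proof (intro Bochner_Integration.integral_cong refl)
    fix v :: real
    have arg: "2 * pi * (t - (t + \<sigma> / (2 * pi) * v)) / \<sigma> = - v" using s by simp
    have const: "\<sigma> / (2 * pi) * (sqrt (2 * pi) / \<sigma>) = 1 / sqrt (2 * pi)"
      using s real_sqrt_mult_self[of "2 * pi"] by (simp add: field_simps)
    have "\<sigma> / (2 * pi) * (bump P n (t + \<sigma> / (2 * pi) * v) * (sqrt (2 * pi) / \<sigma> * exp (- v\<^sup>2 / 2)))
       = (\<sigma> / (2 * pi) * (sqrt (2 * pi) / \<sigma>)) * exp (- v\<^sup>2 / 2) * bump P n (t + \<sigma> / (2 * pi) * v)"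
      by (simp only: mult_ac)
    thus "\<sigma> / (2 * pi) * (bump P n (t + \<sigma> / (2 * pi) * v) *
         (sqrt (2 * pi) / \<sigma> * exp (- (2 * pi * (t - (t + \<sigma> / (2 * pi) * v)) / \<sigma>)\<^sup>2 / 2)))
       = std_normal_density v * bump P n (t + \<sigma> / (2 * pi) * v)"
      unfolding arg const power2_minus std_normal_density_def .
  qed
  finally show ?thesis .
qed

text \<open>
  Inversion follows by inserting the Gaussian factor \<open>exp (- (\<sigma> y)\<^sup>2 / 2)\<close> and letting \<open>\<sigma>\<close> tend to \<open>0\<close> along
  \<open>1 / (k + 1)\<close>, with dominated convergence on both sides of \<open>gaussian_mean\<close>.
\<close>

lemma fourier_inversion:
  assumes even: "\<And>u. bump P n (- u) = bump P n u"
  shows "(LINT y|lborel. of_real (costrans (bump P n) 0 y) * iexp (2 * pi * t * y)) = of_real (bump P n t)"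
proof -
  let ?\<sigma> = "\<lambda>k. 1 / real (Suc k)"
  have \<sigma>: "?\<sigma> \<longlonglongrightarrow> 0" using LIMSEQ_inverse_real_of_nat by (simp add: inverse_eq_divide)
  define h where "h y = of_real (costrans (bump P n) 0 y) * iexp (2 * pi * t * y)" for y
  have hint: "integrable lborel h" unfolding h_def[abs_def]
    by (rule integrable_costrans_mult) auto
  have 1: "(\<lambda>k. LINT y|lborel. h y * of_real (exp (- (?\<sigma> k * y)\<^sup>2 / 2))) \<longlonglongrightarrow> (LINT y|lborel. h y)"
  proof (rule integral_dominated_convergence[where w="\<lambda>y. norm (h y)"])
    show "integrable lborel (\<lambda>y. norm (h y))" using hint by simp
    show "AE y in lborel. (\<lambda>k. h y * of_real (exp (- (?\<sigma> k * y)\<^sup>2 / 2))) \<longlonglongrightarrow> h y"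
    proof (intro always_eventually allI)
      fix y
      have "(\<lambda>k. h y * of_real (exp (- (?\<sigma> k * y)\<^sup>2 / 2))) \<longlonglongrightarrow> h y * of_real (exp (- (0 * y)\<^sup>2 / 2))"
        by (intro tendsto_intros \<sigma>) auto
      thus "(\<lambda>k. h y * of_real (exp (- (?\<sigma> k * y)\<^sup>2 / 2))) \<longlonglongrightarrow> h y" by simp
    qed
    show "AE y in lborel. norm (h y * of_real (exp (- (?\<sigma> k * y)\<^sup>2 / 2))) \<le> norm (h y)" for k
      by (intro always_eventually allI) (auto simp: norm_mult intro!: mult_left_le)
  qed (use hint in \<open>auto simp: h_def\<close>)
  have 2: "(LINT y|lborel. h y * of_real (exp (- (?\<sigma> k * y)\<^sup>2 / 2)))
      = of_real (LINT v|lborel. std_normal_density v * bump P n (t + ?\<sigma> k / (2 * pi) * v))" for k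
    unfolding h_def by (rule gaussian_mean[OF even]) simp
  have 3: "(\<lambda>k. complex_of_real (LINT v|lborel. std_normal_density v * bump P n (t + ?\<sigma> k / (2 * pi) * v)))
      \<longlonglongrightarrow> of_real (LINT v|lborel. std_normal_density v * bump P n t)"
  proof (rule tendsto_of_real)
    obtain C where C: "C \<ge> 0" "\<And>x. \<bar>bump P n x\<bar> \<le> C" using bump_rapid[of P n] by metis
    show "(\<lambda>k. LINT v|lborel. std_normal_density v * bump P n (t + ?\<sigma> k / (2 * pi) * v))
        \<longlonglongrightarrow> (LINT v|lborel. std_normal_density v * bump P n t)"
    proof (rule integral_dominated_convergence[where w="\<lambda>v. std_normal_density v * C"])
      show "integrable lborel (\<lambda>v. std_normal_density v * C)" by (intro integrable_mult_left) simp
      show "AE v in lborel. (\<lambda>k. std_normal_density v * bump P n (t + ?\<sigma> k / (2 * pi) * v))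
          \<longlonglongrightarrow> std_normal_density v * bump P n t"
      proof (intro always_eventually allI)
        fix v
        have "isCont (bump P n) t"
          using has_real_derivative_bump DERIV_isCont by blast
        moreover have "(\<lambda>k. t + ?\<sigma> k / (2 * pi) * v) \<longlonglongrightarrow> t + 0 / (2 * pi) * v"
          by (intro tendsto_intros \<sigma>) auto
        ultimately have "(\<lambda>k. bump P n (t + ?\<sigma> k / (2 * pi) * v)) \<longlonglongrightarrow> bump P n t"
          by (intro isCont_tendsto_compose[of t "bump P n"]) auto
        thus "(\<lambda>k. std_normal_density v * bump P n (t + ?\<sigma> k / (2 * pi) * v))
          \<longlonglongrightarrow> std_normal_density v * bump P n t" by (intro tendsto_intros)
      qed
      show "AE v in lborel. norm (std_normal_density v * bump P n (t + ?\<sigma> k / (2 * pi) * v)) \<le> std_normal_density v * C" for k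
        by (intro always_eventually allI) (auto simp: abs_mult intro!: mult_left_mono C)
    qed auto
  qed
  have 4: "(LINT v|lborel. std_normal_density v * bump P n t) = bump P n t" by simp
  show ?thesis
    using LIMSEQ_unique[OF 1[unfolded 2] 3[unfolded 4]] by (simp add: h_def)
qed

section \<open>The kernel\<close>

lemma integral_product_rescale:
  assumes x: "x > 0" "1 \<le> real M * x"
  shows "integral {- real M..real M} (\<lambda>t. bump P n (x * t) * costrans (bump R m) 0 (y * t))
    = (1 / x) * integral {-1..1} (\<lambda>s. bump P n s * costrans (bump R m) 0 (y / x * s))"
proof -
  have "integral {- real M..real M} (\<lambda>t. bump P n (x * t) * costrans (bump R m) 0 (y * t))
    = (LINT t|lborel. bump P n (x * t) * costrans (bump R m) 0 (y * t))"
  proof (rule integral_eq_lborel_of_support)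
    fix t assume "real M \<le> \<bar>t\<bar>"
    hence "real M * x \<le> \<bar>t\<bar> * x" using x by (intro mult_right_mono) auto
    hence "1 \<le> \<bar>t\<bar> * x" using x by linarith
    hence "1 \<le> \<bar>x * t\<bar>" using x by (simp add: abs_mult mult.commute[of x])
    thus "bump P n (x * t) * costrans (bump R m) 0 (y * t) = 0" by (simp add: bump_eq_0)
  qed (intro continuous_intros)
  also have "\<dots> = \<bar>1 / x\<bar> *\<^sub>R (LINT s|lborel. bump P n (x * (0 + 1 / x * s)) * costrans (bump R m) 0 (y * (0 + 1 / x * s)))"
    using x by (intro lborel_integral_real_affine) simp
  also have "\<dots> = (1 / x) * (LINT s|lborel. bump P n s * costrans (bump R m) 0 (y / x * s))"
    using x by simp
  also have "(LINT s|lborel. bump P n s * costrans (bump R m) 0 (y / x * s))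
    = integral {-1..1} (\<lambda>s. bump P n s * costrans (bump R m) 0 (y / x * s))"
  proof (rule integral_eq_lborel_of_support[symmetric])
    show "continuous_on UNIV (\<lambda>s. bump P n s * costrans (bump R m) 0 (y / x * s))"
      by (intro continuous_intros)
  qed (simp add: bump_eq_0)
  finally show ?thesis .
qed

text \<open>
  The multiplication formula for the Fourier transform, by Fubini.
\<close>

lemma integral_costrans_swap:
  "integral {-1..1} (\<lambda>s. bump P n s * costrans (bump R m) 0 (c * s))
   = integral {-1..1} (\<lambda>s. bump R m s * costrans (bump P n) 0 (c * s))"
proof -
  have "integral {-1..1} (\<lambda>s. bump P n s * costrans (bump R m) 0 (c * s))
    = integral (cbox (-1) 1) (\<lambda>s. integral (cbox (-1) 1) (\<lambda>u. bump P n s * (bump R m u * cos (2 * pi * u * (c * s)))))"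
    by (simp add: costrans_def)
  also have "\<dots> = integral (cbox (-1) 1) (\<lambda>u. integral (cbox (-1) 1) (\<lambda>s. bump P n s * (bump R m u * cos (2 * pi * u * (c * s)))))"
    by (rule integral_swap_continuous) (auto simp: split_beta intro!: continuous_intros)
  also have "\<dots> = integral {-1..1} (\<lambda>u. bump R m u * costrans (bump P n) 0 (c * u))"
    by (simp add: costrans_def integral_mult_right[symmetric] mult_ac del: integral_mult_right integral_mult_left)
  finally show ?thesis .
qed

lemma sum_even_function:
  fixes G :: "real \<Rightarrow> real"
  assumes "\<And>t. G (- t) = G t"
  shows "(\<Sum>i<2 * M. G (real i - real M)) + G (real M) = G 0 + 2 * (\<Sum>j=1..M. G (real j))"
proof (induction M)
  case (Suc M)
  have "(\<Sum>i<2 * Suc M. G (real i - real (Suc M)))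
      = G (- real (Suc M)) + (\<Sum>i<Suc (2 * M). G (real (Suc i) - real (Suc M)))"
    by (simp only: mult_Suc_right add_2_eq_Suc sum.lessThan_Suc_shift) simp
  also have "\<dots> = G (real (Suc M)) + ((\<Sum>i<2 * M. G (real i - real M)) + G (real M))"
    by (simp add: assms del: of_nat_Suc) (simp add: assms)
  finally show ?case using Suc.IH by simp
qed simp

text \<open>
  Two even bumps: \<open>eta\<close> has \<open>eta 0 = 1\<close>, while \<open>phi\<close> has \<open>phi 0 = 0\<close> and total integral \<open>1\<close>.
  These normalisations give \<open>wedge 0 0 = -1\<close> for the function below.
\<close>

definition eta :: "real \<Rightarrow> real" where
  "eta = bump [:exp 1:] 0"

text \<open>
  The integral of the unnormalised form of \<open>phi\<close>.
\<close>

definition phi_mass :: real where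
  "phi_mass = integral {-1..1} (bump [:0, 0, 1:] 0)"

definition phi :: "real \<Rightarrow> real" where
  "phi = bump [:0, 0, 1 / phi_mass:] 0"

lemma bump_nonneg: "(\<And>x. poly P x \<ge> 0) \<Longrightarrow> bump P 0 x \<ge> 0"
  by (simp add: bump_def)

lemma phi_mass_nonzero: "phi_mass \<noteq> 0"
proof
  assume "phi_mass = 0"
  hence "\<forall>x\<in>{-1..1}. bump [:0, 0, 1:] 0 x = 0"
    unfolding phi_mass_def
    by (subst (asm) integral_eq_0_iff) (auto intro!: continuous_on_bump[OF continuous_on_id] simp: bump_nonneg)
  hence "bump [:0, 0, 1:] 0 (1 / 2) = 0" by (rule bspec) auto
  thus False by (simp add: bump_def)
qed

lemma eta_0 [simp]: "eta 0 = 1" and phi_0 [simp]: "phi 0 = 0"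
  by (simp_all add: eta_def phi_def bump_def exp_minus)

lemma eta_minus [simp]: "eta (- x) = eta x" and phi_minus [simp]: "phi (- x) = phi x"
  by (simp_all add: eta_def phi_def bump_minus)

lemma eta_eq_0: "\<bar>x\<bar> \<ge> 1 \<Longrightarrow> eta x = 0" and phi_eq_0: "\<bar>x\<bar> \<ge> 1 \<Longrightarrow> phi x = 0"
  by (simp_all add: eta_def phi_def bump_eq_0)

lemma costrans_phi_0 [simp]: "costrans phi 0 0 = 1"
proof -
  have "phi = (\<lambda>u. 1 / phi_mass * bump [:0, 0, 1:] 0 u)"
    by (simp add: phi_def fun_eq_iff bump_smult)
  hence "costrans phi 0 0 = integral {-1..1} (\<lambda>u. 1 / phi_mass * bump [:0, 0, 1:] 0 u)"
    by (simp add: costrans_def)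
  also have "\<dots> = 1 / phi_mass * phi_mass"
    unfolding phi_mass_def integral_mult_right ..
  finally show ?thesis using phi_mass_nonzero by simp
qed

lemma costrans_eta_0_pos: "costrans eta 0 0 > 0"
proof -
  have ge: "costrans eta 0 0 \<ge> 0"
    unfolding costrans_def
    by (rule integral_nonneg)
      (auto simp: eta_def bump_nonneg intro: integrable_continuous_interval continuous_on_bump[OF continuous_on_id])
  have "costrans eta 0 0 \<noteq> 0"
  proof
    assume "costrans eta 0 0 = 0"
    hence "\<forall>x\<in>{-1..1}. eta x = 0"
      unfolding costrans_def
      by (simp, subst (asm) integral_eq_0_iff) (auto intro!: continuous_on_bump[OF continuous_on_id] simp: eta_def bump_nonneg)
    hence "eta 0 = 0" by (rule bspec) auto
    thus False by simp
  qed
  thus ?thesis using ge by simp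
qed

text \<open>
  The antisymmetrisation of \<open>phi(x) eta(y)\<close> under exchange of the two bumps, Fourier transformed in the second
  variable. Its integral along every line through the origin with \<open>x > 0\<close> vanishes, by the multiplication formula.
\<close>

definition wedge :: "real \<Rightarrow> real \<Rightarrow> real" where
  "wedge x y = phi x * costrans eta 0 y - eta x * costrans phi 0 y"

text \<open>
  The function \<open>p\<^sub>q\<close> of the expansion. Terms with \<open>j > Q / q\<close> would vanish because \<open>wedge\<close> is supported in
  \<open>\<bar>x\<bar> \<le> 1\<close>, and \<open>wedge\<close> is even, so this is the sum over all integers \<open>j \<noteq> 0\<close>.
\<close>

definition delta_kernel :: "real \<Rightarrow> nat \<Rightarrow> real \<Rightarrow> real" where
  "delta_kernel Q q z = 2 * (\<Sum>j=1..nat \<lfloor>Q / real q\<rfloor>. wedge (real j * real q / Q) (real j * real q * Q * z))"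

lemma wedge_minus: "wedge (- x) (- y) = wedge x y"
  by (simp add: wedge_def costrans_0_minus)

lemma wedge_0: "wedge 0 0 = -1"
  by (simp add: wedge_def)

lemma wedge_eq_0: "\<bar>x\<bar> \<ge> 1 \<Longrightarrow> wedge x y = 0"
  by (simp add: wedge_def eta_eq_0 phi_eq_0)

text \<open>
  Full sums of \<open>wedge\<close> along a line through the origin are small: the integrals that they approximate cancel.
\<close>

lemma sum_wedge_le:
  obtains C where "C \<ge> 0" "\<And>x y M. x > 0 \<Longrightarrow> 1 \<le> real M * x \<Longrightarrow>
    \<bar>\<Sum>i<2 * M. wedge (x * (real i - real M)) (y * (real i - real M))\<bar> \<le> C * max x \<bar>y\<bar> ^ N"
proof -
  define A where "A x y t = phi (x * t) * costrans eta 0 (y * t)" for x y t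
  define B where "B x y t = eta (x * t) * costrans phi 0 (y * t)" for x y t
  obtain C where C: "C \<ge> 0" "\<And>x y M. x > 0 \<Longrightarrow> 1 \<le> real M * x \<Longrightarrow>
    \<bar>(\<Sum>i<2 * M. A x y (real i - real M)) - integral {- real M..real M} (A x y)\<bar> \<le> C * max x \<bar>y\<bar> ^ N"
    using sum_product_approx_integral[where N = N and P = "[:0, 0, 1 / phi_mass:]" and n = 0
          and R = "[:exp 1:]" and m = 0 and \<alpha> = 0]
    unfolding A_def eta_def phi_def by blast
  obtain D where D: "D \<ge> 0" "\<And>x y M. x > 0 \<Longrightarrow> 1 \<le> real M * x \<Longrightarrow>
    \<bar>(\<Sum>i<2 * M. B x y (real i - real M)) - integral {- real M..real M} (B x y)\<bar> \<le> D * max x \<bar>y\<bar> ^ N"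
    using sum_product_approx_integral[where N = N and P = "[:exp 1:]" and n = 0
          and R = "[:0, 0, 1 / phi_mass:]" and m = 0 and \<alpha> = 0]
    unfolding B_def eta_def phi_def by blast
  have "\<bar>\<Sum>i<2 * M. wedge (x * (real i - real M)) (y * (real i - real M))\<bar> \<le> (C + D) * max x \<bar>y\<bar> ^ N"
    if xM: "x > 0" "1 \<le> real M * x" for x y M
  proof -
    have "integral {- real M..real M} (A x y) = integral {- real M..real M} (B x y)"
      unfolding A_def B_def eta_def phi_def integral_product_rescale[OF xM]
      by (subst integral_costrans_swap) (rule refl)
    moreover have "(\<Sum>i<2 * M. wedge (x * (real i - real M)) (y * (real i - real M)))
      = (\<Sum>i<2 * M. A x y (real i - real M)) - (\<Sum>i<2 * M. B x y (real i - real M))"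
      by (simp add: wedge_def A_def B_def sum_subtractf)
    ultimately show ?thesis
      using C(2)[OF xM, of y] D(2)[OF xM, of y] unfolding distrib_right by linarith
  qed
  thus ?thesis using that[of "C + D"] C(1) D(1) by simp
qed

text \<open>
  The full sum differs from the kernel by the term \<open>j = 0\<close>, which is \<open>-1\<close>. With \<open>N = 0\<close> this bounds the
  kernel everywhere.
\<close>

lemma delta_kernel_minus_1:
  obtains C where "C \<ge> 0" "\<And>Q q z. Q > 0 \<Longrightarrow> 1 \<le> q \<Longrightarrow>
    \<bar>delta_kernel Q q z - 1\<bar> \<le> C * max (real q / Q) \<bar>real q * Q * z\<bar> ^ N"
proof -
  obtain C where C: "C \<ge> 0" "\<And>x y M. x > 0 \<Longrightarrow> 1 \<le> real M * x \<Longrightarrow>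
    \<bar>\<Sum>i<2 * M. wedge (x * (real i - real M)) (y * (real i - real M))\<bar> \<le> C * max x \<bar>y\<bar> ^ N"
    using sum_wedge_le[where N = N] by blast
  have "\<bar>delta_kernel Q q z - 1\<bar> \<le> C * max (real q / Q) \<bar>real q * Q * z\<bar> ^ N" if Q: "Q > 0" and q: "1 \<le> q" for Q q z
  proof -
    define x where "x = real q / Q"
    define y where "y = real q * Q * z"
    define M where "M = Suc (nat \<lfloor>Q / real q\<rfloor>)"
    define G where "G t = wedge (x * t) (y * t)" for t
    have x: "x > 0" using Q q by (simp add: x_def)
    have "Q / real q \<le> real M" unfolding M_def by linarith
    hence Mx: "1 \<le> real M * x" using Q q by (simp add: x_def field_simps)
    \<comment> \<open>\<open>M\<close> exceeds the upper summation limit by one, so that the endpoint terms vanish.\<close>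
    have GM: "G (real M) = 0" unfolding G_def using Mx by (intro wedge_eq_0) (simp add: mult.commute)
    have "(\<Sum>i<2 * M. G (real i - real M)) + G (real M) = G 0 + 2 * (\<Sum>j=1..M. G (real j))"
      by (rule sum_even_function) (simp add: G_def wedge_minus)
    moreover have "G 0 = -1" by (simp add: G_def wedge_0)
    moreover have "2 * (\<Sum>j=1..M. G (real j)) = delta_kernel Q q z"
      using GM unfolding delta_kernel_def M_def by (simp add: G_def x_def y_def mult_ac)
    ultimately have "delta_kernel Q q z - 1 = (\<Sum>i<2 * M. G (real i - real M))" using GM by linarith
    thus ?thesis using C(2)[OF x Mx, of y] by (simp add: G_def x_def y_def)
  qed
  thus ?thesis using that[of C] C(1) by blast
qed

lemma sum_inverse_squares_le: "(\<Sum>j=1..n. 1 / (real j)\<^sup>2) \<le> 2"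
proof -
  have "(\<Sum>j=1..Suc n. 1 / (real j)\<^sup>2) \<le> 2 - 1 / real (Suc n)" for n
  proof (induction n)
    case (Suc n)
    have "1 / (real (Suc (Suc n)))\<^sup>2 \<le> 1 / real (Suc n) - 1 / real (Suc (Suc n))"
      by (simp add: divide_simps power2_eq_square) 
    thus ?case using Suc.IH by simp
  qed simp
  from this[of n] have "(\<Sum>j=1..Suc n. 1 / (real j)\<^sup>2) \<le> 2" by (smt (verit) divide_nonneg_nonneg of_nat_0_le_iff)
  moreover have "(\<Sum>j=1..n. 1 / (real j)\<^sup>2) \<le> (\<Sum>j=1..Suc n. 1 / (real j)\<^sup>2)" by simp
  ultimately show ?thesis by linarith
qed

lemma wedge_decay:
  obtains C where "C \<ge> 0" "\<And>x y. \<bar>y\<bar> ^ N * \<bar>wedge x y\<bar> \<le> C"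
proof -
  obtain A where A: "A \<ge> 0" "\<And>x. \<bar>phi x\<bar> \<le> A" unfolding phi_def using bump_rapid by metis
  obtain B where B: "B \<ge> 0" "\<And>x. \<bar>eta x\<bar> \<le> B" unfolding eta_def using bump_rapid by metis
  obtain A' where A': "A' \<ge> 0" "\<And>y. \<bar>y\<bar> ^ N * \<bar>costrans eta 0 y\<bar> \<le> A'"
    unfolding eta_def using costrans_decay by blast
  obtain B' where B': "B' \<ge> 0" "\<And>y. \<bar>y\<bar> ^ N * \<bar>costrans phi 0 y\<bar> \<le> B'"
    unfolding phi_def using costrans_decay by blast
  have "\<bar>y\<bar> ^ N * \<bar>wedge x y\<bar> \<le> A * A' + B * B'" for x y
  proof -
    have "\<bar>wedge x y\<bar> \<le> \<bar>phi x\<bar> * \<bar>costrans eta 0 y\<bar> + \<bar>eta x\<bar> * \<bar>costrans phi 0 y\<bar>"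
      unfolding wedge_def abs_mult[symmetric] by (rule abs_triangle_ineq4)
    hence "\<bar>y\<bar> ^ N * \<bar>wedge x y\<bar> \<le> \<bar>y\<bar> ^ N * (\<bar>phi x\<bar> * \<bar>costrans eta 0 y\<bar> + \<bar>eta x\<bar> * \<bar>costrans phi 0 y\<bar>)"
      by (intro mult_left_mono) auto
    also have "\<dots> = \<bar>phi x\<bar> * (\<bar>y\<bar> ^ N * \<bar>costrans eta 0 y\<bar>) + \<bar>eta x\<bar> * (\<bar>y\<bar> ^ N * \<bar>costrans phi 0 y\<bar>)"
      by (simp add: algebra_simps)
    also have "\<dots> \<le> A * A' + B * B'"
      by (intro add_mono mult_mono A B A' B') auto
    finally show ?thesis .
  qed
  thus ?thesis using that[of "A * A' + B * B'"] A(1) B(1) A'(1) B'(1) by simp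
qed

lemma delta_kernel_decay:
  obtains C where "C \<ge> 0" "\<And>Q q z. \<bar>real q * Q * z\<bar> ^ (N + 2) * \<bar>delta_kernel Q q z\<bar> \<le> C"
proof -
  obtain C where C: "C \<ge> 0" "\<And>x y. \<bar>y\<bar> ^ (N + 2) * \<bar>wedge x y\<bar> \<le> C" using wedge_decay by blast
  have "\<bar>real q * Q * z\<bar> ^ (N + 2) * \<bar>delta_kernel Q q z\<bar> \<le> 4 * C" for Q q z
  proof -
    define y where "y = real q * Q * z"
    define n where "n = nat \<lfloor>Q / real q\<rfloor>"
    have "\<bar>y\<bar> ^ (N + 2) * \<bar>delta_kernel Q q z\<bar>
       \<le> \<bar>y\<bar> ^ (N + 2) * (2 * (\<Sum>j=1..n. \<bar>wedge (real j * real q / Q) (real j * y)\<bar>))"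
      unfolding delta_kernel_def n_def[symmetric] abs_mult y_def
      by (intro mult_left_mono) (auto intro!: order_trans[OF sum_abs] simp: mult.assoc)
    also have "\<dots> = 2 * (\<Sum>j=1..n. \<bar>y\<bar> ^ (N + 2) * \<bar>wedge (real j * real q / Q) (real j * y)\<bar>)"
      by (simp add: sum_distrib_left mult_ac)
    also have "\<dots> \<le> 2 * (\<Sum>j=1..n. C * (1 / (real j)\<^sup>2))"
    proof (intro mult_left_mono sum_mono)
      fix j assume "j \<in> {1..n}"
      hence j: "real j \<ge> 1" by auto
      \<comment> \<open>Two of the \<open>N + 2\<close> powers make the sum over \<open>j\<close> converge uniformly.\<close>
      have "(real j)\<^sup>2 \<le> real j ^ (N + 2)" using j by (intro power_increasing) auto
      hence "(real j)\<^sup>2 * (\<bar>y\<bar> ^ (N + 2) * \<bar>wedge (real j * real q / Q) (real j * y)\<bar>)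
        \<le> real j ^ (N + 2) * (\<bar>y\<bar> ^ (N + 2) * \<bar>wedge (real j * real q / Q) (real j * y)\<bar>)"
        by (intro mult_right_mono) auto
      also have "\<dots> = \<bar>real j * y\<bar> ^ (N + 2) * \<bar>wedge (real j * real q / Q) (real j * y)\<bar>"
        by (simp only: abs_mult power_mult_distrib abs_of_nat mult.assoc)
      also have "\<dots> \<le> C" by (rule C)
      finally show "\<bar>y\<bar> ^ (N + 2) * \<bar>wedge (real j * real q / Q) (real j * y)\<bar> \<le> C * (1 / (real j)\<^sup>2)"
        using j by (simp add: pos_le_divide_eq mult.commute)
    qed simp
    also have "\<dots> \<le> 2 * (C * 2)"
      unfolding sum_distrib_left[symmetric]
      by (intro mult_left_mono sum_inverse_squares_le C) auto
    finally show ?thesis by (simp add: y_def)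
  qed
  thus ?thesis using that[of "4 * C"] C(1) by simp
qed

lemma smooth_of_derivative_sequence:
  assumes "F 0 = f" "\<And>k x. (F k has_vector_derivative F (Suc k) x) (at x)"
  shows "smooth f"
proof -
  have "((\<lambda>g t. vector_derivative g (at t)) ^^ k) f = F k" for k
  proof (induction k)
    case (Suc k)
    have "vector_derivative (F k) (at t) = F (Suc k) t" for t
      by (rule vector_derivative_at[OF assms(2)])
    thus ?case by (simp add: Suc.IH)
  qed (simp add: assms(1))
  thus ?thesis using assms(2) by (auto simp: smooth_def intro: differentiableI_vector)
qed

text \<open>
  The derivatives of \<open>costrans\<close> are again of this form, which gives every derivative of the kernel explicitly.
\<close>

lemma smooth_delta_kernel: "smooth (\<lambda>z. complex_of_real (delta_kernel Q q z))"
proof -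
  define \<Theta> where "\<Theta> = (\<lambda>P. smult (2 * pi) (pCons 0 P))"
  define T where "T P k = costrans (bump ((\<Theta> ^^ k) P) 0) (real k * (pi / 2))" for P k
  define b where "b j = real j * real q * Q" for j
  define F where "F k z = 2 * (\<Sum>j=1..nat \<lfloor>Q / real q\<rfloor>.
      phi (real j * real q / Q) * (b j ^ k * T [:exp 1:] k (b j * z))
      - eta (real j * real q / Q) * (b j ^ k * T [:0, 0, 1 / phi_mass:] k (b j * z)))" for k z
  have T: "(T P k has_real_derivative T P (Suc k) y) (at y)" for P k y
  proof -
    have "real k * (pi / 2) + pi / 2 = real (Suc k) * (pi / 2)" by (simp add: field_simps)
    thus ?thesis
      using has_real_derivative_costrans[of "(\<Theta> ^^ k) P" 0 "real k * (pi / 2)" y]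
      by (simp only: T_def funpow.simps o_def) (simp only: \<Theta>_def)
  qed
  have T': "((\<lambda>z. b j ^ k * T P k (b j * z)) has_real_derivative b j ^ Suc k * T P (Suc k) (b j * z)) (at z)" for P k j z
    using DERIV_cmult[OF DERIV_chain2[OF T[of P k "b j * z"] DERIV_cmult_Id], of "b j ^ k"] by (simp add: mult_ac)
  have F: "(F k has_real_derivative F (Suc k) z) (at z)" for k z
    unfolding F_def[abs_def] by (intro DERIV_cmult DERIV_sum DERIV_diff T')
  show ?thesis
  proof (rule smooth_of_derivative_sequence)
    show "(\<lambda>z. complex_of_real (F 0 z)) = (\<lambda>z. complex_of_real (delta_kernel Q q z))"
      by (simp add: F_def delta_kernel_def wedge_def T_def b_def eta_def phi_def)
    show "((\<lambda>z. complex_of_real (F k z)) has_vector_derivative complex_of_real (F (Suc k) z)) (at z)" for k z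
      using F by (intro has_vector_derivative_of_real) (simp add: has_real_derivative_iff_has_vector_derivative[symmetric])
  qed
qed

section \<open>Exponential sums over fractions\<close>

lemma e_eq_iexp: "e x = iexp (2 * pi * x)"
  by (simp add: e_def mult_ac)

lemma e_add: "e (x + y) = e x * e y"
  by (simp add: e_def exp_add[symmetric] algebra_simps)

lemma norm_e [simp]: "norm (e x) = 1"
  by (simp add: e_eq_iexp)

lemma e_power: "e x ^ k = e (real k * x)"
  by (simp add: e_def exp_of_nat_mult[symmetric] mult_ac)

lemma e_eq_1_iff: "e x = 1 \<longleftrightarrow> x \<in> \<int>"
proof -
  have "e x = 1 \<longleftrightarrow> (\<exists>k. 2 * pi * x = real_of_int (2 * k) * pi)"
    by (simp add: e_def exp_eq_1)
  also have "\<dots> \<longleftrightarrow> (\<exists>k. x = real_of_int k)" by auto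
  finally show ?thesis by (auto simp: Ints_def)
qed

lemma sum_roots_of_unity:
  assumes "d \<ge> 1"
  shows "(\<Sum>b=1..d. e (real b / real d * of_int n)) = (if int d dvd n then of_nat d else 0)"
proof -
  define w where "w = e (of_int n / real d)"
  have b: "e (real b / real d * of_int n) = w ^ b" for b
    by (simp add: w_def e_power)
  have w1: "w = 1 \<longleftrightarrow> int d dvd n"
  proof -
    have "w = 1 \<longleftrightarrow> (\<exists>k. of_int n / real d = real_of_int k)"
      unfolding w_def e_eq_1_iff by (auto simp: Ints_def)
    also have "\<dots> \<longleftrightarrow> (\<exists>k. real_of_int n = real_of_int (int d * k))"
      using assms by (simp add: field_simps)
    finally show ?thesis unfolding of_int_eq_iff dvd_def .
  qed
  have "w ^ d = e (of_int n)" using assms by (simp add: w_def e_power)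
  hence wd: "w ^ d = 1" by (simp add: e_eq_1_iff)
  show ?thesis
  proof (cases "int d dvd n")
    case False
    have "(\<Sum>b=1..d. w ^ b) = (\<Sum>b<d. w ^ Suc b)"
      by (rule sum.reindex_bij_witness[of _ Suc "\<lambda>b. b - 1"]) auto
    also have "\<dots> = w * (\<Sum>b<d. w ^ b)" by (simp add: sum_distrib_left)
    also have "(\<Sum>b<d. w ^ b) = (w ^ d - 1) / (w - 1)"
      using False w1 by (intro geometric_sum) auto
    finally have "(\<Sum>b=1..d. w ^ b) = 0" by (simp add: wd)
    thus ?thesis using False by (simp only: b if_False)
  qed (use w1 b in simp)
qed

text \<open>
  Each fraction \<open>b / d\<close> in \<open>(0, 1]\<close> is written uniquely in lowest terms \<open>a / q\<close>, with \<open>q\<close> a divisor of \<open>d\<close>.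
\<close>

lemma sum_fractions_by_lowest_terms:
  fixes f :: "real \<Rightarrow> 'a::comm_monoid_add"
  assumes "d \<ge> 1"
  shows "(\<Sum>b=1..d. f (real b / real d))
    = (\<Sum>q | q dvd d. \<Sum>a\<in>{a. 1 \<le> a \<and> a \<le> q \<and> gcd a q = 1}. f (real a / real q))"
proof -
  have fin: "finite {q. q dvd d}" using assms by simp
  have "(\<Sum>b=1..d. f (real b / real d)) =
    (\<Sum>(q, a)\<in>(SIGMA q:{q. q dvd d}. {a. 1 \<le> a \<and> a \<le> q \<and> gcd a q = 1}). f (real a / real q))"
  proof (rule sum.reindex_bij_witness[of _ "\<lambda>(q, a). a * (d div q)" "\<lambda>b. (d div gcd b d, b div gcd b d)"])
    fix b assume b: "b \<in> {1..d}"
    define g where "g = gcd b d"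
    have g: "g dvd b" "g dvd d" "g > 0" using assms by (auto simp: g_def)
    obtain b' d' where bd: "b = g * b'" "d = g * d'" using g by (auto elim!: dvdE)
    have pos: "b' > 0" "d' > 0" using b bd g assms by (auto intro!: Nat.gr0I)
    have co: "gcd b' d' = 1"
      using g(3) bd g_def by (metis gcd_mult_distrib_nat mult_cancel1 mult.right_neutral neq0_conv)
    have dv: "d div g = d'" "b div g = b'" using bd g by auto
    have le: "b' \<le> d'" using b bd g by auto
    show "(case (d div gcd b d, b div gcd b d) of (q, a) \<Rightarrow> a * (d div q)) = b"
      unfolding g_def[symmetric] dv using bd pos by simp
    show "(d div gcd b d, b div gcd b d) \<in> (SIGMA q:{q. q dvd d}. {a. 1 \<le> a \<and> a \<le> q \<and> gcd a q = 1})"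
      unfolding g_def[symmetric] dv using bd pos co le by auto
    show "(case (d div gcd b d, b div gcd b d) of (q, a) \<Rightarrow> f (real a / real q)) = f (real b / real d)"
      unfolding g_def[symmetric] dv using bd pos g by simp
  next
    fix x assume x: "x \<in> (SIGMA q:{q. q dvd d}. {a. 1 \<le> a \<and> a \<le> q \<and> gcd a q = 1})"
    obtain q a where xqa: "x = (q, a)" by (cases x)
    have qa: "q dvd d" "1 \<le> a" "a \<le> q" "gcd a q = 1" using x xqa by auto
    obtain k where k: "d = q * k" using qa by (auto elim: dvdE)
    have k0: "k > 0" "q > 0" using k assms by (auto intro!: Nat.gr0I)
    have dq: "d div q = k" using k k0 by simp
    have g: "gcd (a * k) d = k"
      using qa(4) k by (metis gcd_mult_distrib_nat mult.commute mult.right_neutral)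
    show "(\<lambda>b. (d div gcd b d, b div gcd b d)) (case x of (q, a) \<Rightarrow> a * (d div q)) = x"
      unfolding xqa prod.case dq g using k k0 by simp
    have "a * k \<le> q * k" using qa by simp
    thus "(case x of (q, a) \<Rightarrow> a * (d div q)) \<in> {1..d}"
      unfolding xqa prod.case dq using k k0 qa by auto
  qed
  also have "\<dots> = (\<Sum>q | q dvd d. \<Sum>a\<in>{a. 1 \<le> a \<and> a \<le> q \<and> gcd a q = 1}. f (real a / real q))"
    by (rule sum.Sigma[symmetric]) (use fin in auto)
  finally show ?thesis .
qed

text \<open>
  Reordering by \<open>d = j q\<close>.
\<close>

lemma sum_by_multiples:
  fixes h :: "nat \<Rightarrow> nat \<Rightarrow> 'a::comm_monoid_add"
  assumes "Q \<ge> 1"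
  shows "(\<Sum>q\<in>{q::nat. 1 \<le> q \<and> real q \<le> Q}. \<Sum>j=1..nat \<lfloor>Q / real q\<rfloor>. h q (j * q))
    = (\<Sum>d=1..nat \<lfloor>Q\<rfloor>. \<Sum>q | q dvd d. h q d)"
proof -
  have fin: "finite {q::nat. 1 \<le> q \<and> real q \<le> Q}"
    by (rule finite_subset[of _ "{..nat \<lfloor>Q\<rfloor>}"]) (auto simp: le_nat_floor)
  have le_iff: "d \<le> nat \<lfloor>x\<rfloor> \<longleftrightarrow> real d \<le> x" if "x \<ge> 0" for d :: nat and x :: real
    using that by (simp add: le_nat_iff le_floor_iff)
  have "(\<Sum>q\<in>{q::nat. 1 \<le> q \<and> real q \<le> Q}. \<Sum>j=1..nat \<lfloor>Q / real q\<rfloor>. h q (j * q))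
    = (\<Sum>(q, j)\<in>(SIGMA q:{q::nat. 1 \<le> q \<and> real q \<le> Q}. {1..nat \<lfloor>Q / real q\<rfloor>}). h q (j * q))"
    by (rule sum.Sigma) (use fin in auto)
  also have "\<dots> = (\<Sum>(d, q)\<in>(SIGMA d:{1..nat \<lfloor>Q\<rfloor>}. {q. q dvd d}). h q d)"
  proof (rule sum.reindex_bij_witness[of _ "\<lambda>(d, q). (q, d div q)" "\<lambda>(q, j). (j * q, q)"])
    fix x assume "x \<in> (SIGMA q:{q::nat. 1 \<le> q \<and> real q \<le> Q}. {1..nat \<lfloor>Q / real q\<rfloor>})"
    then obtain q j where x: "x = (q, j)" "1 \<le> q" "real q \<le> Q" "1 \<le> j" "j \<le> nat \<lfloor>Q / real q\<rfloor>" by auto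
    have "real j \<le> Q / real q" using x le_iff[of "Q / real q"] assms by simp
    hence "real (j * q) \<le> Q" using x by (simp add: field_simps)
    hence "j * q \<le> nat \<lfloor>Q\<rfloor>" using le_iff[of Q "j * q"] assms by simp
    thus "(\<lambda>(q, j). (j * q, q)) x \<in> (SIGMA d:{1..nat \<lfloor>Q\<rfloor>}. {q. q dvd d})" using x by auto
    show "(\<lambda>(d, q). (q, d div q)) ((\<lambda>(q, j). (j * q, q)) x) = x" using x by simp
    show "(case (\<lambda>(q, j). (j * q, q)) x of (d, q) \<Rightarrow> h q d) = (case x of (q, j) \<Rightarrow> h q (j * q))"
      using x by simp
  next
    fix x assume "x \<in> (SIGMA d:{1..nat \<lfloor>Q\<rfloor>}. {q. q dvd d})"
    then obtain d q where x: "x = (d, q)" "1 \<le> d" "d \<le> nat \<lfloor>Q\<rfloor>" "q dvd d" by auto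
    then obtain j where j: "d = q * j" by (auto elim: dvdE)
    have pos: "q > 0" "j > 0" using j x by (auto intro!: Nat.gr0I)
    have dQ: "real d \<le> Q" using x le_iff[of Q d] assms by simp
    have "q \<le> d" using pos j by simp
    hence "real q \<le> Q" using dQ by linarith
    moreover have "real j \<le> Q / real q" using dQ j pos by (simp add: field_simps)
    hence "j \<le> nat \<lfloor>Q / real q\<rfloor>" using le_iff[of "Q / real q" j] assms by simp
    ultimately show "(\<lambda>(d, q). (q, d div q)) x \<in> (SIGMA q:{q::nat. 1 \<le> q \<and> real q \<le> Q}. {1..nat \<lfloor>Q / real q\<rfloor>})"
      using x j pos by simp
    show "(\<lambda>(q, j). (j * q, q)) ((\<lambda>(d, q). (q, d div q)) x) = x" using x j pos by simp
  qed
  also have "\<dots> = (\<Sum>d=1..nat \<lfloor>Q\<rfloor>. \<Sum>q | q dvd d. h q d)"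
    by (rule sum.Sigma[symmetric]) auto
  finally show ?thesis .
qed

section \<open>The main term\<close>

lemma fourier_inversion_scaled:
  assumes even: "\<And>u. bump P n (- u) = bump P n u" and "\<kappa> > 0"
  shows "has_bochner_integral lborel (\<lambda>z. of_real (costrans (bump P n) 0 (\<kappa> * z)) * e (z * x))
    (of_real (bump P n (x / \<kappa>) / \<kappa>))"
proof -
  define h where "h y = of_real (costrans (bump P n) 0 y) * iexp (2 * pi * (x / \<kappa>) * y)" for y
  have "integrable lborel h"
    unfolding h_def[abs_def] by (rule integrable_costrans_mult) auto
  moreover have "integral\<^sup>L lborel h = of_real (bump P n (x / \<kappa>))"
    unfolding h_def by (rule fourier_inversion[OF even])
  ultimately have "has_bochner_integral lborel h (of_real (bump P n (x / \<kappa>)))"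
    by (simp only: has_bochner_integral_iff simp_thms)
  hence "has_bochner_integral lborel (\<lambda>z. h (0 + \<kappa> * z)) (of_real (bump P n (x / \<kappa>)) /\<^sub>R \<bar>\<kappa>\<bar>)"
    using lborel_has_bochner_integral_real_affine_iff[of \<kappa> h _ 0] assms(2) by simp
  moreover have "h (0 + \<kappa> * z) = of_real (costrans (bump P n) 0 (\<kappa> * z)) * e (z * x)" for z
    using assms(2) by (simp add: h_def e_eq_iexp mult_ac)
  ultimately show ?thesis using assms(2) by (simp add: scaleR_conv_of_real divide_inverse mult.commute)
qed

text \<open>
  The \<open>n\<close>-th Fourier coefficient of the summand of \<open>delta_kernel Q q\<close> with \<open>j q = d\<close>. It depends on \<open>j\<close> and \<open>q\<close>
  only through \<open>d\<close>.
\<close>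

definition delta_coeff :: "real \<Rightarrow> int \<Rightarrow> nat \<Rightarrow> real" where
  "delta_coeff Q n d = 2 / (real d * Q) *
     (phi (real d / Q) * eta (of_int n / (real d * Q)) - eta (real d / Q) * phi (of_int n / (real d * Q)))"

lemma fourier_delta_kernel:
  assumes "Q > 0" "1 \<le> q"
  shows "has_bochner_integral lborel (\<lambda>z. of_real (delta_kernel Q q z) * e ((x + z) * of_int n))
    (\<Sum>j=1..nat \<lfloor>Q / real q\<rfloor>. of_real (delta_coeff Q n (j * q)) * e (x * of_int n))"
proof -
  have "has_bochner_integral lborel
     (\<lambda>z. \<Sum>j=1..nat \<lfloor>Q / real q\<rfloor>. 2 * e (x * of_int n) *
       (of_real (phi (real j * real q / Q)) * (of_real (costrans eta 0 (real j * real q * Q * z)) * e (z * of_int n))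
        - of_real (eta (real j * real q / Q)) * (of_real (costrans phi 0 (real j * real q * Q * z)) * e (z * of_int n))))
     (\<Sum>j=1..nat \<lfloor>Q / real q\<rfloor>. 2 * e (x * of_int n) *
       (of_real (phi (real j * real q / Q)) * of_real (eta (of_int n / (real j * real q * Q)) / (real j * real q * Q))
        - of_real (eta (real j * real q / Q)) * of_real (phi (of_int n / (real j * real q * Q)) / (real j * real q * Q))))"
    (is "has_bochner_integral lborel ?L ?R")
  proof (intro has_bochner_integral_sum has_bochner_integral_mult_right has_bochner_integral_diff)
    fix j assume "j \<in> {1..nat \<lfloor>Q / real q\<rfloor>}"
    hence pos: "real j * real q * Q > 0" using assms by auto
    show "has_bochner_integral lborel (\<lambda>z. of_real (costrans eta 0 (real j * real q * Q * z)) * e (z * of_int n))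
      (of_real (eta (of_int n / (real j * real q * Q)) / (real j * real q * Q)))"
      using fourier_inversion_scaled[of "[:exp 1:]" 0, OF _ pos] eta_minus unfolding eta_def by blast
    show "has_bochner_integral lborel (\<lambda>z. of_real (costrans phi 0 (real j * real q * Q * z)) * e (z * of_int n))
      (of_real (phi (of_int n / (real j * real q * Q)) / (real j * real q * Q)))"
      using fourier_inversion_scaled[of "[:0, 0, 1 / phi_mass:]" 0, OF _ pos] phi_minus unfolding phi_def by blast
  qed
  moreover have "?L = (\<lambda>z. of_real (delta_kernel Q q z) * e ((x + z) * of_int n))"
    by (simp add: fun_eq_iff delta_kernel_def wedge_def distrib_right e_add sum_distrib_left sum_distrib_right algebra_simps)
  moreover have "?R = (\<Sum>j=1..nat \<lfloor>Q / real q\<rfloor>. of_real (delta_coeff Q n (j * q)) * e (x * of_int n))"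
    by (intro sum.cong refl) (simp add: delta_coeff_def diff_divide_distrib algebra_simps)
  ultimately show ?thesis by simp
qed

text \<open>
  The sum of \<open>F q a\<close> over the reduced fractions \<open>a / q\<close> in \<open>(0, 1]\<close> with denominator at most \<open>Q\<close>.
\<close>

definition farey_sum :: "real \<Rightarrow> (nat \<Rightarrow> nat \<Rightarrow> complex) \<Rightarrow> complex" where
  "farey_sum Q F = (\<Sum>q\<in>{q::nat. 1 \<le> q \<and> real q \<le> Q}. \<Sum>a\<in>{a::nat. 1 \<le> a \<and> a \<le> q \<and> gcd a q = 1}. F q a)"

lemma farey_sum_integral:
  assumes "Q \<ge> 1"
  shows "farey_sum Q (\<lambda>q a. LINT z|lborel. of_real (delta_kernel Q q z) * e ((real a / real q + z) * of_int n))
    = of_real (\<Sum>d | d \<in> {1..nat \<lfloor>Q\<rfloor>} \<and> int d dvd n. real d * delta_coeff Q n d)"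
proof -
  let ?A = "\<lambda>q. {a::nat. 1 \<le> a \<and> a \<le> q \<and> gcd a q = 1}"
  have "farey_sum Q (\<lambda>q a. LINT z|lborel. of_real (delta_kernel Q q z) * e ((real a / real q + z) * of_int n))
    = (\<Sum>q\<in>{q::nat. 1 \<le> q \<and> real q \<le> Q}. \<Sum>a\<in>?A q.
        \<Sum>j=1..nat \<lfloor>Q / real q\<rfloor>. of_real (delta_coeff Q n (j * q)) * e (real a / real q * of_int n))"
    unfolding farey_sum_def
    by (intro sum.cong refl has_bochner_integral_integral_eq fourier_delta_kernel) (use assms in auto)
  also have "\<dots> = (\<Sum>q\<in>{q::nat. 1 \<le> q \<and> real q \<le> Q}. \<Sum>j=1..nat \<lfloor>Q / real q\<rfloor>.
       (\<lambda>q d. of_real (delta_coeff Q n d) * (\<Sum>a\<in>?A q. e (real a / real q * of_int n))) q (j * q))"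
    by (subst sum.swap) (simp add: sum_distrib_left)
  also have "\<dots> = (\<Sum>d=1..nat \<lfloor>Q\<rfloor>. \<Sum>q | q dvd d. of_real (delta_coeff Q n d) * (\<Sum>a\<in>?A q. e (real a / real q * of_int n)))"
    by (rule sum_by_multiples[OF assms])
  also have "\<dots> = (\<Sum>d=1..nat \<lfloor>Q\<rfloor>. of_real (delta_coeff Q n d) * (if int d dvd n then of_nat d else 0))"
  proof (intro sum.cong refl)
    fix d assume "d \<in> {1..nat \<lfloor>Q\<rfloor>}"
    hence d: "d \<ge> 1" by simp
    show "(\<Sum>q | q dvd d. of_real (delta_coeff Q n d) * (\<Sum>a\<in>?A q. e (real a / real q * of_int n)))
      = of_real (delta_coeff Q n d) * (if int d dvd n then of_nat d else 0)"
      using sum_fractions_by_lowest_terms[OF d, of "\<lambda>r. e (r * of_int n)"] sum_roots_of_unity[OF d, of n]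
      by (simp add: sum_distrib_left[symmetric])
  qed
  also have "\<dots> = (\<Sum>d\<in>{1..nat \<lfloor>Q\<rfloor>}. if int d dvd n then of_real (real d * delta_coeff Q n d) else 0)"
    by (intro sum.cong refl) simp
  also have "\<dots> = (\<Sum>d | d \<in> {1..nat \<lfloor>Q\<rfloor>} \<and> int d dvd n. of_real (real d * delta_coeff Q n d))"
    by (rule sum.inter_filter[symmetric]) simp
  finally show ?thesis by simp
qed

text \<open>
  The summand is antisymmetric under the involution \<open>d \<mapsto> \<bar>n\<bar> / d\<close> of the divisors of \<open>n\<close>. The restriction
  \<open>d \<le> Q\<close> is harmless because \<open>phi(d / Q)\<close> and \<open>eta(d / Q)\<close> vanish for larger \<open>d\<close>.
\<close>

lemma divisor_sum_eq_0:
  assumes "Q > 0" "n \<noteq> 0"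
  shows "(\<Sum>d | d \<in> {1..nat \<lfloor>Q\<rfloor>} \<and> int d dvd n. real d * delta_coeff Q n d) = 0"
proof -
  define m where "m = nat \<bar>n\<bar>"
  have m0: "m > 0" using assms by (simp add: m_def)
  have dvd_iff: "int d dvd n \<longleftrightarrow> d dvd m" for d
    unfolding m_def by (metis dvd_abs_iff int_dvd_int_iff abs_ge_zero nat_0_le)
  define A where "A d = phi (real d / Q)" for d :: nat
  define B where "B d = eta (real d / Q)" for d :: nat
  have summand: "real d * delta_coeff Q n d = 2 / Q * (A d * B (m div d) - B d * A (m div d))" if "d dvd m" for d
  proof -
    have d0: "d > 0" using that m0 by (auto intro!: Nat.gr0I)
    have "real (m div d) = real m / real d" using that by (rule real_of_nat_div)
    hence q: "real (m div d) / Q = \<bar>of_int n\<bar> / (real d * Q)" by (simp add: m_def)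
    have "B (m div d) = eta (of_int n / (real d * Q))" "A (m div d) = phi (of_int n / (real d * Q))"
      unfolding A_def B_def q by (cases "n \<ge> 0"; simp add: abs_if)+
    thus ?thesis using d0 by (simp add: delta_coeff_def A_def B_def)
  qed
  have zero: "A d = 0" "B d = 0" if "d > nat \<lfloor>Q\<rfloor>" for d
  proof -
    have "real d \<ge> Q" using that by linarith
    hence "\<bar>real d / Q\<bar> \<ge> 1" using assms by simp
    thus "A d = 0" "B d = 0" by (simp_all add: A_def B_def phi_eq_0 eta_eq_0)
  qed
  have "(\<Sum>d | d \<in> {1..nat \<lfloor>Q\<rfloor>} \<and> int d dvd n. real d * delta_coeff Q n d)
    = (\<Sum>d | d \<in> {1..nat \<lfloor>Q\<rfloor>} \<and> d dvd m. 2 / Q * (A d * B (m div d) - B d * A (m div d)))"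
    unfolding dvd_iff by (intro sum.cong refl) (use summand in auto)
  also have "\<dots> = (\<Sum>d | d dvd m. 2 / Q * (A d * B (m div d) - B d * A (m div d)))"
  proof (rule sum.mono_neutral_left)
    show "\<forall>d\<in>{d. d dvd m} - {d \<in> {1..nat \<lfloor>Q\<rfloor>}. d dvd m}. 2 / Q * (A d * B (m div d) - B d * A (m div d)) = 0"
    proof
      fix d assume d: "d \<in> {d. d dvd m} - {d \<in> {1..nat \<lfloor>Q\<rfloor>}. d dvd m}"
      hence "d > 0" using m0 by (auto intro!: Nat.gr0I)
      hence "d > nat \<lfloor>Q\<rfloor>" using d by auto
      thus "2 / Q * (A d * B (m div d) - B d * A (m div d)) = 0" using zero by simp
    qed
  qed (use m0 in auto)
  also have "\<dots> = 2 / Q * ((\<Sum>d | d dvd m. A d * B (m div d)) - (\<Sum>d | d dvd m. B d * A (m div d)))"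
    unfolding sum_distrib_left[symmetric] sum_subtractf ..
  also have "(\<Sum>d | d dvd m. A d * B (m div d)) = (\<Sum>d | d dvd m. B d * A (m div d))"
    by (rule sum.reindex_bij_witness[of _ "\<lambda>d. m div d" "\<lambda>d. m div d"])
      (use m0 in \<open>auto elim!: dvdE\<close>)
  finally show ?thesis by simp
qed

text \<open>
  For \<open>n = 0\<close> the divisor sum is the Riemann sum \<open>(2 / Q) \<Sum> phi(d / Q)\<close> over \<open>1 \<le> d \<le> Q\<close>, which approximates
  the integral of the even function \<open>phi\<close>, that is \<open>1\<close>.
\<close>

lemma divisor_sum_0_approx:
  obtains C where "C \<ge> 0" "\<And>Q. Q \<ge> 1 \<Longrightarrow>
    \<bar>(\<Sum>d | d \<in> {1..nat \<lfloor>Q\<rfloor>} \<and> int d dvd 0. real d * delta_coeff Q 0 d) - 1\<bar> \<le> C / Q ^ N"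
proof -
  define h where "h = costrans eta 0 0"
  have h: "h > 0" unfolding h_def by (rule costrans_eta_0_pos)
  \<comment> \<open>The summation formula is stated for products; here the second factor is the constant \<open>h\<close>, taking \<open>y = 0\<close>.\<close>
  obtain C where C: "C \<ge> 0" "\<And>x y M. x > 0 \<Longrightarrow> 1 \<le> real M * x \<Longrightarrow>
    \<bar>(\<Sum>i<2 * M. phi (x * (real i - real M)) * costrans eta 0 (y * (real i - real M)))
      - integral {- real M..real M} (\<lambda>t. phi (x * t) * costrans eta 0 (y * t))\<bar> \<le> C * max x \<bar>y\<bar> ^ N"
    using sum_product_approx_integral[where N = N and P = "[:0, 0, 1 / phi_mass:]" and n = 0
          and R = "[:exp 1:]" and m = 0 and \<alpha> = 0]
    unfolding eta_def phi_def by blast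
  have "\<bar>(\<Sum>d | d \<in> {1..nat \<lfloor>Q\<rfloor>} \<and> int d dvd 0. real d * delta_coeff Q 0 d) - 1\<bar> \<le> (C / h) / Q ^ N"
    if Q: "Q \<ge> 1" for Q
  proof -
    define M where "M = Suc (nat \<lfloor>Q\<rfloor>)"
    define G where "G t = phi (1 / Q * t)" for t
    have "Q \<le> real M" unfolding M_def by linarith
    hence Mx: "1 \<le> real M * (1 / Q)" using Q by simp
    have x0: "1 / Q > 0" using Q by simp
    have GM: "G (real M) = 0" unfolding G_def using Mx Q by (intro phi_eq_0) (simp add: mult.commute)
    have "integral {- real M..real M} (\<lambda>t. phi (1 / Q * t) * costrans eta 0 (0 * t))
       = Q * integral {-1..1} (\<lambda>s. phi s * costrans eta 0 (0 / (1 / Q) * s))"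
      using integral_product_rescale[OF x0 Mx, of "[:0, 0, 1 / phi_mass:]" 0 "[:exp 1:]" 0 0] Q
      unfolding phi_def eta_def by simp
    also have "\<dots> = Q * (costrans phi 0 0 * h)" by (simp add: costrans_def[of phi] h_def)
    finally have int: "integral {- real M..real M} (\<lambda>t. phi (1 / Q * t) * costrans eta 0 (0 * t)) = Q * h" by simp
    have "(\<Sum>i<2 * M. phi (1 / Q * (real i - real M)) * costrans eta 0 (0 * (real i - real M)))
      = (\<Sum>i<2 * M. G (real i - real M)) * h"
      by (simp add: G_def h_def sum_distrib_right)
    also have "(\<Sum>i<2 * M. G (real i - real M)) = 2 * (\<Sum>j=1..M. G (real j))"
      using sum_even_function[of G M] GM by (simp add: G_def)
    also have "(\<Sum>j=1..M. G (real j)) = (\<Sum>j=1..nat \<lfloor>Q\<rfloor>. G (real j))"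
      using GM by (simp add: M_def)
    finally have sum: "(\<Sum>i<2 * M. phi (1 / Q * (real i - real M)) * costrans eta 0 (0 * (real i - real M)))
      = 2 * (\<Sum>j=1..nat \<lfloor>Q\<rfloor>. G (real j)) * h" .
    have "\<bar>2 * (\<Sum>j=1..nat \<lfloor>Q\<rfloor>. G (real j)) * h - Q * h\<bar> \<le> C * (1 / Q) ^ N"
      using C(2)[OF x0 Mx, of 0] Q unfolding int sum by simp
    moreover have "2 * (\<Sum>j=1..nat \<lfloor>Q\<rfloor>. G (real j)) * h - Q * h = Q * h * (2 / Q * (\<Sum>j=1..nat \<lfloor>Q\<rfloor>. G (real j)) - 1)"
      using Q by (simp add: field_simps)
    moreover have "(\<Sum>d | d \<in> {1..nat \<lfloor>Q\<rfloor>} \<and> int d dvd 0. real d * delta_coeff Q 0 d)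
        = 2 / Q * (\<Sum>j=1..nat \<lfloor>Q\<rfloor>. G (real j))"
    proof -
      have "real d * delta_coeff Q 0 d = 2 / Q * G (real d)" if "d \<in> {1..nat \<lfloor>Q\<rfloor>}" for d
        using that Q by (simp add: delta_coeff_def G_def)
      moreover have "{d. d \<in> {1..nat \<lfloor>Q\<rfloor>} \<and> int d dvd 0} = {1..nat \<lfloor>Q\<rfloor>}" by auto
      ultimately show ?thesis by (simp add: sum_distrib_left)
    qed
    ultimately have "(Q * h) * \<bar>(\<Sum>d | d \<in> {1..nat \<lfloor>Q\<rfloor>} \<and> int d dvd 0. real d * delta_coeff Q 0 d) - 1\<bar> \<le> C / Q ^ N"
      using Q h by (simp add: abs_mult power_divide)
    moreover have "h * \<bar>(\<Sum>d | d \<in> {1..nat \<lfloor>Q\<rfloor>} \<and> int d dvd 0. real d * delta_coeff Q 0 d) - 1\<bar>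
      \<le> (Q * h) * \<bar>(\<Sum>d | d \<in> {1..nat \<lfloor>Q\<rfloor>} \<and> int d dvd 0. real d * delta_coeff Q 0 d) - 1\<bar>"
      using Q h by (intro mult_right_mono) auto
    ultimately have "h * \<bar>(\<Sum>d | d \<in> {1..nat \<lfloor>Q\<rfloor>} \<and> int d dvd 0. real d * delta_coeff Q 0 d) - 1\<bar> \<le> C / Q ^ N"
      by linarith
    hence "\<bar>(\<Sum>d | d \<in> {1..nat \<lfloor>Q\<rfloor>} \<and> int d dvd 0. real d * delta_coeff Q 0 d) - 1\<bar> \<le> C / Q ^ N / h"
      using h by (simp only: pos_le_divide_eq mult.commute)
    thus ?thesis by (simp only: divide_divide_eq_left mult.commute)
  qed
  thus ?thesis using that[of "C / h"] C(1) h by simp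
qed

section \<open>Truncation and the expansion\<close>

lemma power_nat_ceiling_le_powr:
  fixes x :: real
  assumes "0 < x" "x \<le> 1" "N \<ge> 0"
  shows "x ^ nat \<lceil>N\<rceil> \<le> x powr N"
proof -
  have "N \<le> real (nat \<lceil>N\<rceil>)" by linarith
  hence "x powr real (nat \<lceil>N\<rceil>) \<le> x powr N" using assms by (intro powr_mono') auto
  thus ?thesis by (simp only: powr_realpow[OF assms(1)])
qed

lemma delta_main_term:
  obtains C where "C \<ge> 0" "\<And>Q n. Q \<ge> 1 \<Longrightarrow>
    norm (delta0 n - farey_sum Q (\<lambda>q a. LINT z|lborel. of_real (delta_kernel Q q z) * e ((real a / real q + z) * of_int n)))
      \<le> C / Q ^ N"
proof -
  obtain C where C: "C \<ge> 0" "\<And>Q. Q \<ge> 1 \<Longrightarrow>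
    \<bar>(\<Sum>d | d \<in> {1..nat \<lfloor>Q\<rfloor>} \<and> int d dvd 0. real d * delta_coeff Q 0 d) - 1\<bar> \<le> C / Q ^ N"
    using divisor_sum_0_approx by blast
  have "norm (delta0 n - farey_sum Q (\<lambda>q a. LINT z|lborel. of_real (delta_kernel Q q z) * e ((real a / real q + z) * of_int n)))
      \<le> C / Q ^ N" if Q: "Q \<ge> 1" for Q n
  proof (cases "n = 0")
    case False
    show ?thesis unfolding farey_sum_integral[OF Q]
      using divisor_sum_eq_0[of Q n] False C(1) Q by (simp add: delta0_def)
  next
    case True
    define S where "S = (\<Sum>d | d \<in> {1..nat \<lfloor>Q\<rfloor>} \<and> int d dvd 0. real d * delta_coeff Q 0 d)"
    have "norm (delta0 n - of_real S) = \<bar>1 - S\<bar>"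
      using True by (metis delta0_def norm_of_real of_real_1 of_real_diff)
    thus ?thesis unfolding farey_sum_integral[OF Q] using C(2)[OF Q] True by (simp only: S_def abs_minus_commute)
  qed
  thus ?thesis using that[of C] C(1) by blast
qed

text \<open>
  Truncation to \<open>\<bar>z\<bar> < (q Q)\<^sup>-\<^sup>1\<^sup>+\<^sup>\<theta>\<close> costs little because the kernel decays rapidly once \<open>q Q \<bar>z\<bar>\<close> exceeds \<open>1\<close>.
  The factor \<open>1 / (q Q)\<close> pays for the sum over all \<open>a \<le> q\<close> and all \<open>q \<le> Q\<close>.
\<close>

lemma delta_kernel_tail:
  assumes "\<theta> > 0" "N \<ge> 0"
  obtains C where "C \<ge> 0" "\<And>Q q x n. Q \<ge> 1 \<Longrightarrow> 1 \<le> q \<Longrightarrow>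
    norm ((LINT z|lborel. of_real (delta_kernel Q q z) * e ((x + z) * of_int n))
      - (LBINT z:{z. \<bar>z\<bar> < (real q * Q) powr (-1 + \<theta>)}. of_real (delta_kernel Q q z) * e ((x + z) * of_int n)))
     \<le> C * Q powr (- N * \<theta>) / (real q * Q)"
proof -
  define K where "K = nat \<lceil>N\<rceil>"
  obtain C where C: "C \<ge> 0" "\<And>Q q z. \<bar>real q * Q * z\<bar> ^ (K + 2) * \<bar>delta_kernel Q q z\<bar> \<le> C"
    using delta_kernel_decay by blast
  define J where "J = (LINT y|lborel. 2 * C / (1 + y\<^sup>2))"
  have J0: "J \<ge> 0" unfolding J_def using C(1) by (intro integral_nonneg_AE) auto
  have "norm ((LINT z|lborel. of_real (delta_kernel Q q z) * e ((x + z) * of_int n))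
      - (LBINT z:{z. \<bar>z\<bar> < (real q * Q) powr (-1 + \<theta>)}. of_real (delta_kernel Q q z) * e ((x + z) * of_int n)))
     \<le> J * Q powr (- N * \<theta>) / (real q * Q)" if Q: "Q \<ge> 1" and q: "1 \<le> q" for Q q x n
  proof -
    define \<kappa> where "\<kappa> = real q * Q"
    define A where "A = {z. \<bar>z\<bar> < \<kappa> powr (-1 + \<theta>)}"
    define f where "f z = complex_of_real (delta_kernel Q q z) * e ((x + z) * of_int n)" for z
    define g where "g z = Q powr (- N * \<theta>) * (2 * C / (1 + (\<kappa> * z)\<^sup>2))" for z
    have \<kappa>: "\<kappa> \<ge> 1" "\<kappa> \<ge> Q" unfolding \<kappa>_def using Q q
      by (auto intro: order_trans[OF _ mult_mono[of 1 "real q" 1 Q]] simp: mult_le_cancel_right1)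
    have fint: "integrable lborel f" unfolding f_def[abs_def]
      using fourier_delta_kernel[of Q q x n] Q q by (auto simp: has_bochner_integral_iff)
    have Am: "A \<in> sets lborel" by (simp add: A_def)
    have Aint: "integrable lborel (\<lambda>z. indicator A z *\<^sub>R f z)"
      using fint Am by (rule integrable_mult_indicator[rotated])
    have gint: "integrable lborel g"
      unfolding g_def[abs_def] using lborel_integrable_real_affine[OF integrable_rapid[of "2 * C"], of \<kappa> 0] \<kappa>
      by (intro integrable_mult_right) simp
    have bound: "norm (f z - indicator A z *\<^sub>R f z) \<le> g z" for z
    proof (cases "z \<in> A")
      case True
      thus ?thesis using C(1) by (simp add: g_def)
    next
      case False
      define y where "y = \<bar>\<kappa> * z\<bar>"
      have "\<kappa> powr \<theta> = \<kappa> * \<kappa> powr (-1 + \<theta>)" unfolding powr_add using \<kappa> by (simp add: powr_minus)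
      also have "\<dots> \<le> \<kappa> * \<bar>z\<bar>" using False \<kappa> by (intro mult_left_mono) (auto simp: A_def)
      finally have y: "\<kappa> powr \<theta> \<le> y" using \<kappa> by (simp add: y_def abs_mult)
      have "1 \<le> \<kappa> powr \<theta>" using \<kappa> assms by (simp add: ge_one_powr_ge_zero)
      hence y1: "y \<ge> 1" using y by linarith
      have "Q powr (N * \<theta>) = (Q powr \<theta>) powr N" by (simp add: powr_powr mult.commute)
      also have "\<dots> \<le> y powr N"
        using y \<kappa> Q assms by (intro powr_mono2) (auto intro: order_trans[OF powr_mono2 y])
      also have "\<dots> \<le> y powr real K" unfolding K_def by (intro powr_mono y1) linarith
      also have "\<dots> = y ^ K" using y1 by (intro powr_realpow) auto
      finally have yK: "Q powr (N * \<theta>) \<le> y ^ K" .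
      \<comment> \<open>Of the \<open>K + 2\<close> powers of decay, \<open>K\<close> give the saving and two make the bound integrable.\<close>
      have "(1 + y\<^sup>2) * Q powr (N * \<theta>) \<le> (2 * y\<^sup>2) * y ^ K"
        using y1 by (intro mult_mono yK) (auto simp: one_le_power)
      hence "(1 + y\<^sup>2) * Q powr (N * \<theta>) * \<bar>delta_kernel Q q z\<bar> \<le> (2 * y\<^sup>2) * y ^ K * \<bar>delta_kernel Q q z\<bar>"
        by (intro mult_right_mono) auto
      also have "\<dots> = 2 * (\<bar>real q * Q * z\<bar> ^ (K + 2) * \<bar>delta_kernel Q q z\<bar>)"
        by (simp only: y_def \<kappa>_def power_add mult_ac)
      also have "\<dots> \<le> 2 * C" using C(2) by simp
      finally have "\<bar>delta_kernel Q q z\<bar> \<le> 2 * C / ((1 + y\<^sup>2) * Q powr (N * \<theta>))"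
        using Q by (simp add: pos_le_divide_eq add_pos_nonneg mult.commute)
      also have "\<dots> = g z" using Q by (simp add: g_def y_def powr_minus divide_inverse mult_ac)
      finally show ?thesis using False by (simp add: f_def norm_mult)
    qed
    have "norm ((LINT z|lborel. f z) - (LBINT z:A. f z)) = norm (LINT z|lborel. f z - indicator A z *\<^sub>R f z)"
      unfolding set_lebesgue_integral_def by (simp only: Bochner_Integration.integral_diff[OF fint Aint])
    also have "\<dots> \<le> (LINT z|lborel. norm (f z - indicator A z *\<^sub>R f z))"
      by (rule integral_norm_bound)
    also have "\<dots> \<le> (LINT z|lborel. g z)"
      by (rule integral_mono) (use fint Aint gint bound in auto)
    also have "\<dots> = Q powr (- N * \<theta>) * (J / \<kappa>)"
    proof -
      have "J = \<bar>\<kappa>\<bar> *\<^sub>R (LINT z|lborel. 2 * C / (1 + (0 + \<kappa> * z)\<^sup>2))"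
        unfolding J_def using \<kappa> by (intro lborel_integral_real_affine) auto
      hence "(LINT z|lborel. 2 * C / (1 + (\<kappa> * z)\<^sup>2)) = J / \<kappa>" using \<kappa> by simp
      thus ?thesis unfolding g_def by (simp only: integral_mult_right_zero)
    qed
    finally show ?thesis by (simp add: f_def A_def \<kappa>_def mult_ac)
  qed
  thus ?thesis using that[of J] J0 by blast
qed

lemma delta_expansion:
  assumes "\<theta> > 0" "N \<ge> 0"
  obtains C where "\<And>Q n. Q \<ge> 1 \<Longrightarrow>
    norm (delta0 n - farey_sum Q (\<lambda>q a. LBINT z:{z. \<bar>z\<bar> < (real q * Q) powr (-1 + \<theta>)}.
      of_real (delta_kernel Q q z) * e ((real a / real q + z) * of_int n))) \<le> C * Q powr (- N * \<theta>)"
proof -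
  define K where "K = nat \<lceil>N * \<theta>\<rceil>"
  obtain A where A: "A \<ge> 0" "\<And>Q n. Q \<ge> 1 \<Longrightarrow>
    norm (delta0 n - farey_sum Q (\<lambda>q a. LINT z|lborel. of_real (delta_kernel Q q z) * e ((real a / real q + z) * of_int n)))
      \<le> A / Q ^ K"
    using delta_main_term by blast
  obtain B where B: "B \<ge> 0" "\<And>Q q x n. Q \<ge> 1 \<Longrightarrow> 1 \<le> q \<Longrightarrow>
    norm ((LINT z|lborel. of_real (delta_kernel Q q z) * e ((x + z) * of_int n))
      - (LBINT z:{z. \<bar>z\<bar> < (real q * Q) powr (-1 + \<theta>)}. of_real (delta_kernel Q q z) * e ((x + z) * of_int n)))
     \<le> B * Q powr (- N * \<theta>) / (real q * Q)"
    using delta_kernel_tail[OF assms] by blast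
  show ?thesis
  proof (rule that[of "A + B"])
    fix Q :: real and n :: int
    assume Q: "Q \<ge> 1"
    let ?full = "\<lambda>q a. LINT z|lborel. of_real (delta_kernel Q q z) * e ((real a / real q + z) * of_int n)"
    let ?part = "\<lambda>q a. LBINT z:{z. \<bar>z\<bar> < (real q * Q) powr (-1 + \<theta>)}.
      of_real (delta_kernel Q q z) * e ((real a / real q + z) * of_int n)"
    let ?D = "{q::nat. 1 \<le> q \<and> real q \<le> Q}"
    have main: "norm (delta0 n - farey_sum Q ?full) \<le> A * Q powr (- N * \<theta>)"
    proof -
      have "(1 / Q) ^ K \<le> (1 / Q) powr (N * \<theta>)"
        unfolding K_def using Q assms by (intro power_nat_ceiling_le_powr) auto
      also have "\<dots> = Q powr (- N * \<theta>)" using powr_divide[of 1 Q "N * \<theta>"] powr_minus_divide[of Q "N * \<theta>"] Q by simp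
      finally have "A * (1 / Q) ^ K \<le> A * Q powr (- N * \<theta>)" using A(1) by (rule mult_left_mono)
      thus ?thesis using A(2)[OF Q, of n] by (simp add: power_divide)
    qed
    have "norm (farey_sum Q ?full - farey_sum Q ?part)
      = norm (\<Sum>q\<in>?D. \<Sum>a\<in>{a::nat. 1 \<le> a \<and> a \<le> q \<and> gcd a q = 1}. ?full q a - ?part q a)"
      by (simp only: farey_sum_def sum_subtractf)
    also have "\<dots> \<le> (\<Sum>q\<in>?D. B * Q powr (- N * \<theta>) / Q)"
    proof (rule sum_norm_le)
      fix q assume q: "q \<in> ?D"
      let ?R = "{a::nat. 1 \<le> a \<and> a \<le> q \<and> gcd a q = 1}"
      have "norm (\<Sum>a\<in>?R. ?full q a - ?part q a) \<le> of_nat (card ?R) * (B * Q powr (- N * \<theta>) / (real q * Q))"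
        using q by (intro order_trans[OF norm_sum] sum_bounded_above B(2) Q) auto
      also have "\<dots> \<le> real q * (B * Q powr (- N * \<theta>) / (real q * Q))"
      proof (rule mult_right_mono)
        have "card ?R \<le> card {1..q}" by (rule card_mono) auto
        thus "real (card ?R) \<le> real q" by simp
      qed (use B(1) Q in auto)
      also have "\<dots> = B * Q powr (- N * \<theta>) / Q" using q by auto
      finally show "norm (\<Sum>a\<in>?R. ?full q a - ?part q a) \<le> B * Q powr (- N * \<theta>) / Q" .
    qed
    also have "\<dots> = real (card ?D) * (B * Q powr (- N * \<theta>) / Q)" by simp
    also have "\<dots> \<le> Q * (B * Q powr (- N * \<theta>) / Q)"
    proof (rule mult_right_mono)
      have "card ?D \<le> card {1..nat \<lfloor>Q\<rfloor>}" by (rule card_mono) (auto simp: le_nat_floor)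
      hence "real (card ?D) \<le> real (nat \<lfloor>Q\<rfloor>)" by simp
      thus "real (card ?D) \<le> Q" using Q by linarith
    qed (use B(1) Q in auto)
    also have "\<dots> = B * Q powr (- N * \<theta>)" using Q by simp
    finally have tail: "norm (farey_sum Q ?full - farey_sum Q ?part) \<le> B * Q powr (- N * \<theta>)" .
    have "norm (delta0 n - farey_sum Q ?part)
      \<le> norm (delta0 n - farey_sum Q ?full) + norm (farey_sum Q ?full - farey_sum Q ?part)"
      using norm_triangle_ineq[of "delta0 n - farey_sum Q ?full" "farey_sum Q ?full - farey_sum Q ?part"] by simp
    thus "norm (delta0 n - farey_sum Q ?part) \<le> (A + B) * Q powr (- N * \<theta>)"
      using main tail by (simp only: distrib_right)
  qed
qed

lemma delta_kernel_bounded: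
  obtains C where "\<And>Q q z. Q > 0 \<Longrightarrow> 1 \<le> q \<Longrightarrow> \<bar>delta_kernel Q q z\<bar> \<le> C"
proof -
  obtain C where C: "C \<ge> 0" "\<And>Q q z. Q > 0 \<Longrightarrow> 1 \<le> q \<Longrightarrow>
    \<bar>delta_kernel Q q z - 1\<bar> \<le> C * max (real q / Q) \<bar>real q * Q * z\<bar> ^ 0"
    using delta_kernel_minus_1[where N = 0] by blast
  show ?thesis
  proof (rule that[of "C + 1"])
    fix Q z :: real and q :: nat assume "Q > 0" "1 \<le> q"
    from C(2)[OF this, of z] show "\<bar>delta_kernel Q q z\<bar> \<le> C + 1" by simp
  qed
qed

lemma delta_kernel_near_0:
  assumes "N \<ge> 0"
  obtains C where "\<And>Q q z. Q > 0 \<Longrightarrow> 1 \<le> q \<Longrightarrow> real q \<le> Q \<Longrightarrow> \<bar>z\<bar> \<le> Q powr (-2) \<Longrightarrow>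
    \<bar>delta_kernel Q q z - 1\<bar> \<le> C * (real q / Q) powr N"
proof -
  obtain C where C: "C \<ge> 0" "\<And>Q q z. Q > 0 \<Longrightarrow> 1 \<le> q \<Longrightarrow>
    \<bar>delta_kernel Q q z - 1\<bar> \<le> C * max (real q / Q) \<bar>real q * Q * z\<bar> ^ nat \<lceil>N\<rceil>"
    using delta_kernel_minus_1 by blast
  show ?thesis
  proof (rule that[of C])
    fix Q z :: real and q :: nat
    assume Q: "Q > 0" and q: "1 \<le> q" "real q \<le> Q" and z: "\<bar>z\<bar> \<le> Q powr (-2)"
    have "Q powr (-2) = 1 / Q\<^sup>2"
      using Q by (simp add: powr_minus divide_inverse powr_realpow[of Q 2, simplified])
    hence "\<bar>real q * Q * z\<bar> \<le> real q * Q * (1 / Q\<^sup>2)"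
      using z Q q by (simp add: abs_mult del: times_divide_eq_right) 
    also have "\<dots> = real q / Q" using Q by (simp add: power2_eq_square)
    finally have "max (real q / Q) \<bar>real q * Q * z\<bar> = real q / Q" by simp
    hence "\<bar>delta_kernel Q q z - 1\<bar> \<le> C * (real q / Q) ^ nat \<lceil>N\<rceil>" using C(2)[OF Q q(1), of z] by simp
    also have "\<dots> \<le> C * (real q / Q) powr N"
      using Q q assms by (intro mult_left_mono power_nat_ceiling_le_powr C(1)) auto
    finally show "\<bar>delta_kernel Q q z - 1\<bar> \<le> C * (real q / Q) powr N" .
  qed
qed

theorem proposition1p2:
  shows "\<exists>p :: real \<Rightarrow> nat \<Rightarrow> real \<Rightarrow> complex.
    (\<forall>Q\<ge>1. \<forall>q::nat. 1 \<le> q \<and> real q \<le> Q \<longrightarrow> smooth (p Q q)) \<and>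
    (\<forall>N::real. N \<ge> 0 \<longrightarrow> (\<exists>C::real. \<forall>Q\<ge>1. \<forall>q::nat. 1 \<le> q \<and> real q \<le> Q \<longrightarrow>
        (\<forall>z. norm (p Q q z) \<le> C))) \<and>
    (\<forall>N::real. N \<ge> 0 \<longrightarrow> (\<exists>C::real. \<forall>Q\<ge>1. \<forall>q::nat. 1 \<le> q \<and> real q \<le> Q \<longrightarrow>
        (\<forall>z. \<bar>z\<bar> \<le> Q powr (-2) \<longrightarrow> norm (p Q q z - 1) \<le> C * (real q / Q) powr N))) \<and>
    (\<forall>\<theta>::real. \<theta> > 0 \<longrightarrow> (\<forall>N::real. N \<ge> 0 \<longrightarrow> (\<exists>C::real. \<forall>Q\<ge>1. \<forall>n::int.
        norm (delta0 n -
          (\<Sum>q\<in>{q::nat. 1 \<le> q \<and> real q \<le> Q}. \<Sum>a\<in>{a::nat. 1 \<le> a \<and> a \<le> q \<and> gcd a q = 1}.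
             LBINT z:{z. \<bar>z\<bar> < (real q * Q) powr (-1 + \<theta>)}.
               p Q q z * e ((real a / real q + z) * of_int n)))
        \<le> C * Q powr (- N * \<theta>))))"
proof (rule exI[of _ "\<lambda>Q q z. complex_of_real (delta_kernel Q q z)"], intro conjI allI impI)
  fix Q :: real and q :: nat
  show "smooth (\<lambda>z. complex_of_real (delta_kernel Q q z))" by (rule smooth_delta_kernel)
next
  obtain C where C: "\<And>Q q z. Q > 0 \<Longrightarrow> 1 \<le> q \<Longrightarrow> \<bar>delta_kernel Q q z\<bar> \<le> C"
    using delta_kernel_bounded by blast
  show "\<exists>C::real. \<forall>Q\<ge>1. \<forall>q::nat. 1 \<le> q \<and> real q \<le> Q \<longrightarrow>
        (\<forall>z. norm (complex_of_real (delta_kernel Q q z)) \<le> C)"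
    using C by (intro exI[of _ C]) (simp add: norm_of_real)
next
  fix N :: real assume N: "N \<ge> 0"
  obtain C where C: "\<And>Q q z. Q > 0 \<Longrightarrow> 1 \<le> q \<Longrightarrow> real q \<le> Q \<Longrightarrow> \<bar>z\<bar> \<le> Q powr (-2) \<Longrightarrow>
    \<bar>delta_kernel Q q z - 1\<bar> \<le> C * (real q / Q) powr N"
    using delta_kernel_near_0[OF N] by blast
  have "norm (complex_of_real x - 1) = \<bar>x - 1\<bar>" for x
    by (metis norm_of_real of_real_1 of_real_diff)
  thus "\<exists>C::real. \<forall>Q\<ge>1. \<forall>q::nat. 1 \<le> q \<and> real q \<le> Q \<longrightarrow>
        (\<forall>z. \<bar>z\<bar> \<le> Q powr (-2) \<longrightarrow> norm (complex_of_real (delta_kernel Q q z) - 1) \<le> C * (real q / Q) powr N)"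
    using C by (intro exI[of _ C]) simp
next
  fix \<theta> N :: real assume "\<theta> > 0" "N \<ge> 0"
  from delta_expansion[OF this] obtain C where "\<And>Q n. Q \<ge> 1 \<Longrightarrow>
    norm (delta0 n - farey_sum Q (\<lambda>q a. LBINT z:{z. \<bar>z\<bar> < (real q * Q) powr (-1 + \<theta>)}.
      of_real (delta_kernel Q q z) * e ((real a / real q + z) * of_int n))) \<le> C * Q powr (- N * \<theta>)" by blast
  thus "\<exists>C::real. \<forall>Q\<ge>1. \<forall>n::int.
        norm (delta0 n -
          (\<Sum>q\<in>{q::nat. 1 \<le> q \<and> real q \<le> Q}. \<Sum>a\<in>{a::nat. 1 \<le> a \<and> a \<le> q \<and> gcd a q = 1}.
             LBINT z:{z. \<bar>z\<bar> < (real q * Q) powr (-1 + \<theta>)}.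
               complex_of_real (delta_kernel Q q z) * e ((real a / real q + z) * of_int n)))
        \<le> C * Q powr (- N * \<theta>)"
    unfolding farey_sum_def by (intro exI[of _ C]) blast
qed

end
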